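(* Let $n$ be a positive integer, $\alpha,\beta\in\mathbb{C}$, and let $P_n^{(\alpha,\beta)}$ denote the Jacobi polynomial. For $x\in(-1,1)$ let $A_k,B_k$ (depending on $x,\alpha,\beta$) be the two-point Taylor coefficients of $$f(w)=(1-x)^{-\alpha-\frac12}(1+x)^{-\beta-\frac12}(1-w-x)^{\alpha+\frac12}(1+w+x)^{\beta+\frac12}$$ at the points $\pm w_0$, $w_0=i\sqrt{1-x^2}$, as defined in the context, and for $k=0,1,2,\ldots$ let $$\Phi_k(x,n)=\sum_{j=0}^k\binom{k}{j}\frac{(1-x^2)^{k+j}}{4^j}P_{n-2j}^{(2j-1/2,\,2j-1/2)}(x),$$ $$\Psi_k(x,n)=-\frac12(1-x^2)\sum_{j=0}^k\binom{k}{j}\frac{(1-x^2)^{k+j}}{4^j}P_{n-1-2j}^{(2j+1/2,\,2j+1/2)}(x).$$ Then the expansion $$P_n^{(\alpha,\beta)}(x)=\sum_{k=0}^\infty\left[A_k\,\Phi_k(x,n)+B_k\,\Psi_k(x,n)\right]$$ is convergent for $x\in(-1,1)$. Moreover, $\{\Phi_k(x,n)\}$ and $\{\Psi_k(x,n)\}$ are asymptotic sequences for large $n$, in the sense that for each $k=0,1,2,\ldots$ and fixed $x\in(-1,1)$, as $n\to\infty$, $$\Phi_k(x,n)=\mathcal{O}\!\left(n^{-\lfloor (k+1)/2\rfloor}\right),\qquad \Psi_k(x,n)=\mathcal{O}\!\left(n^{-\lfloor (k+1)/2\rfloor}\right).$$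
   Context: For $x\in(-1,1)$ the Jacobi polynomial is given by $$P_n^{(\alpha,\beta)}(x)=\frac{1}{2\pi i}\frac{(-1)^n}{2^n}\int_\Gamma\frac{(1-w-x)^{n+\alpha}(1+w+x)^{n+\beta}}{(1-x)^\alpha(1+x)^\beta}\frac{dw}{w^{n+1}},$$ where $\Gamma$ is a simple closed positively oriented contour around $w=0$ with the points $w=-x\pm1$ outside it, and $(1-w-x)^\alpha/(1-x)^\alpha$, $(1+w+x)^\beta/(1+x)^\beta$ equal $1$ at $w=0$ (this is the standard Jacobi polynomial). $P_m^{(\alpha,\beta)}=0$ for negative integers $m$. The function $f$ is analytic in $\mathbb{C}\setminus\{(-\infty,-1-x]\cup[1-x,\infty)\}$ with the branch satisfying $f(0)=1$. Its two-point Taylor expansion at $\pm w_0$, $w_0=i\sqrt{1-x^2}$, is $$f(w)=\sum_{k=0}^\infty[A_k+B_kw]\,(w^2-w_0^2)^k=\sum_{k=0}^\infty[A_k+B_kw]\,(w^2+1-x^2)^k,$$ where the coefficients $A_k,B_k$ (independent of $w$ and $n$) are uniquely determined by the requirement that for every $N\ge0$ the function $\big(f(w)-\sum_{k=0}^{N-1}[A_k+B_kw](w^2-w_0^2)^k\big)/(w^2-w_0^2)^N$ is analytic at $w_0$ and $-w_0$. $\lfloor\cdot\rfloor$ is the integer part. *)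

theory Defs
  imports "HOL-Complex_Analysis.Complex_Analysis" "HOL-Library.Landau_Symbols"
begin

section \<open>Jacobi polynomials\<close>

text \<open>
  For real \<open>x\<close> with \<open>-1 < x < 1\<close> the principal branch of \<open>powr\<close> makes
  \<open>w \<mapsto> (1 - w - x) powr a\<close> analytic off \<open>[1 - x, \<infinity>)\<close> and
  \<open>w \<mapsto> (1 + w + x) powr b\<close> analytic off \<open>(-\<infinity>, -1 - x]\<close>; at \<open>w = 0\<close> they
  take the values \<open>(1 - x) powr a\<close> and \<open>(1 + x) powr b\<close>. Hence all quotients below are the branches
  that equal 1 at \<open>w = 0\<close>.
\<close>

definition jacobi_integrand :: "nat \<Rightarrow> complex \<Rightarrow> complex \<Rightarrow> real \<Rightarrow> complex \<Rightarrow> complex" where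
  "jacobi_integrand n \<alpha> \<beta> x w =
     (1 - w - of_real x) powr (of_nat n + \<alpha>) * (1 + w + of_real x) powr (of_nat n + \<beta>)
       / (of_real (1 - x) powr \<alpha> * of_real (1 + x) powr \<beta>) / w ^ (n + 1)"

text \<open>
  The contour is the circle around 0 whose radius is half the distance from 0 to
  \<open>{1 - x, -1 - x}\<close>. By lemma \<open>jacobi_poly_contour\<close> below every closed path that
  winds once around 0 and avoids 0 and both branch cuts gives the same value, and \<open>jacobi_poly_explicit\<close> identifies it with the usual explicit sum.
  The degree is an integer, so that polynomials of negative degree are 0. The definition is
  meant for \<open>-1 < x < 1\<close> only.
\<close>

definition jacobi_poly :: "int \<Rightarrow> complex \<Rightarrow> complex \<Rightarrow> real \<Rightarrow> complex" where
  "jacobi_poly m \<alpha> \<beta> x =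
     (if m < 0 then 0
      else 1 / (2 * of_real pi * \<i>) * ((-1) ^ nat m / 2 ^ nat m) *
             contour_integral (circlepath 0 ((1 - \<bar>x\<bar>) / 2)) (jacobi_integrand (nat m) \<alpha> \<beta> x))"

definition cut_plane :: "real \<Rightarrow> complex set" where
  "cut_plane x = - complex_of_real ` ({..-1 - x} \<union> {1 - x..})"

lemma mem_cut_plane_iff:
  "w \<in> cut_plane x \<longleftrightarrow> 1 - w - of_real x \<notin> \<real>\<^sub>\<le>\<^sub>0 \<and> 1 + w + of_real x \<notin> \<real>\<^sub>\<le>\<^sub>0"
  by (auto simp: cut_plane_def complex_nonpos_Reals_iff image_iff complex_eq_iff)

lemma open_cut_plane: "open (cut_plane x)"
proof -
  have "closed (complex_of_real ` S)" if "closed S" for S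
  proof -
    have "complex_of_real ` S = {z. Im z = 0} \<inter> Re -` S"
      by (auto simp: image_iff complex_eq_iff)
    then show ?thesis
      using that by (auto intro!: closed_Int closed_vimage continuous_intros
                          simp: closed_halfspace_Im_eq)
  qed
  then have "closed (complex_of_real ` ({..-1 - x} \<union> {1 - x..}))"
    by (auto intro!: closed_Un)
  then show ?thesis unfolding cut_plane_def by (rule open_Compl)
qed

lemma starlike_cut_plane:
  assumes "-1 < x" "x < 1"
  shows   "starlike (cut_plane x)"
proof -
  have "closed_segment 0 w \<subseteq> cut_plane x" if "w \<in> cut_plane x" for w
  proof
    fix v assume "v \<in> closed_segment 0 w"
    then obtain u where u: "0 \<le> u" "u \<le> 1" "v = of_real u * w"
      by (auto simp: closed_segment_def scaleR_conv_of_real)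
    show "v \<in> cut_plane x"
    proof (rule ccontr)
      assume "v \<notin> cut_plane x"
      then obtain t where t: "v = of_real t" "t \<le> -1 - x \<or> t \<ge> 1 - x"
        by (auto simp: cut_plane_def)
      have "u \<noteq> 0" using u t assms by auto
      then have "w = of_real (t / u)" using u t by (auto simp: field_simps)
      moreover have "t / u \<le> -1 - x \<or> t / u \<ge> 1 - x"
      proof -
        have "t / u \<le> -1 - x" if "t \<le> -1 - x"
        proof -
          have "t \<le> t * u" using u(1,2) that assms mult_left_le[of u "-t"] by (auto)
          have "(-1 - x) * u \<ge> -1 - x" using u(1,2) assms mult_left_le[of u "1 + x"] by (auto simp: algebra_simps)
          then show ?thesis using that u \<open>u \<noteq> 0\<close> by (simp add: divide_simps)
        qed
        moreover have "t / u \<ge> 1 - x" if "t \<ge> 1 - x"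
        proof -
          have "(1 - x) * u \<le> 1 - x" using u(1,2) assms mult_left_le[of u "1 - x"] by auto
          then show ?thesis using that u \<open>u \<noteq> 0\<close> by (simp add: divide_simps)
        qed
        ultimately show ?thesis using t by auto
      qed
      ultimately have "w \<in> complex_of_real ` ({..-1 - x} \<union> {1 - x..})" by blast
      then show False using \<open>w \<in> cut_plane x\<close> by (simp add: cut_plane_def)
    qed
  qed
  moreover have "0 \<in> cut_plane x" using assms by (auto simp: cut_plane_def)
  ultimately show ?thesis unfolding starlike_def by blast
qed

lemma jacobi_integrand_holomorphic:
  "jacobi_integrand n \<alpha> \<beta> x holomorphic_on (cut_plane x - {0})"
proof (cases "x = 1 \<or> x = -1")
  case True
  then have "jacobi_integrand n \<alpha> \<beta> x = (\<lambda>_. 0)"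
    by (auto simp: jacobi_integrand_def)
  then show ?thesis by simp
next
  case False
  then have "complex_of_real (1 - x) \<noteq> 0" "complex_of_real (1 + x) \<noteq> 0"
    by (auto simp only: of_real_eq_0_iff)
  then have "complex_of_real (1 - x) powr \<alpha> * complex_of_real (1 + x) powr \<beta> \<noteq> 0"
    by (simp del: of_real_diff of_real_add)
  then show ?thesis
    unfolding jacobi_integrand_def
    by (intro holomorphic_intros) (auto simp: mem_cut_plane_iff simp del: of_real_diff of_real_add)
qed

lemma jacobi_residue:
  assumes x: "-1 < x" "x < 1"
    and "valid_path \<gamma>" "pathfinish \<gamma> = pathstart \<gamma>" "path_image \<gamma> \<subseteq> cut_plane x - {0}"
    and "winding_number \<gamma> 0 = 1"
  shows "contour_integral \<gamma> (jacobi_integrand n \<alpha> \<beta> x) =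
           2 * of_real pi * \<i> * residue (jacobi_integrand n \<alpha> \<beta> x) 0"
proof -
  have "simply_connected (cut_plane x)"
    using starlike_cut_plane[OF x] starlike_imp_simply_connected by blast
  then have "contour_integral \<gamma> (jacobi_integrand n \<alpha> \<beta> x) =
     2 * pi * \<i> * (\<Sum>p\<in>{0}. winding_number \<gamma> p * residue (jacobi_integrand n \<alpha> \<beta> x) p)"
    using assms jacobi_integrand_holomorphic open_cut_plane
    by (intro Residue_theorem[where S = "cut_plane x"] simply_connected_imp_connected)
       (auto intro!: simply_connected_imp_winding_number_zero dest: valid_path_imp_path)
  then show ?thesis using assms by simp
qed

lemma jacobi_circle:
  assumes "-1 < x" "x < 1"
  shows   "path_image (circlepath 0 ((1 - \<bar>x\<bar>) / 2)) \<subseteq> cut_plane x - {0}"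
  using assms by (auto simp: cut_plane_def)

lemma jacobi_poly_contour:
  assumes x: "-1 < x" "x < 1"
    and "valid_path \<gamma>" "pathfinish \<gamma> = pathstart \<gamma>" "path_image \<gamma> \<subseteq> cut_plane x - {0}"
    and "winding_number \<gamma> 0 = 1"
  shows "jacobi_poly (int n) \<alpha> \<beta> x =
           1 / (2 * of_real pi * \<i>) * ((-1) ^ n / 2 ^ n) *
             contour_integral \<gamma> (jacobi_integrand n \<alpha> \<beta> x)"
proof -
  have "winding_number (circlepath 0 ((1 - \<bar>x\<bar>) / 2)) 0 = 1"
    using x by (intro winding_number_circlepath) auto
  then show ?thesis
    using x jacobi_residue[OF assms] jacobi_residue[OF x _ _ jacobi_circle[OF x], where n = n]
    by (simp add: jacobi_poly_def)
qed

lemma has_fps_expansion_powr_linear: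
  fixes a c :: complex and d :: real
  assumes "d > 0"
  shows "(\<lambda>w. (of_real d + c * w) powr a) has_fps_expansion
           Abs_fps (\<lambda>k. of_real d powr a * (a gchoose k) * (c / of_real d) ^ k)"
proof (cases "c = 0")
  case True
  then have "Abs_fps (\<lambda>k. of_real d powr a * (a gchoose k) * (c / of_real d) ^ k) =
      fps_const (of_real d powr a)"
    by (auto simp: fps_eq_iff)
  with True show ?thesis by auto
next
  case False
  have *: "(\<lambda>k. of_real d powr a * (a gchoose k) * (c / of_real d) ^ k * w ^ k) sums
          (of_real d + c * w) powr a" if "norm w < d / norm c" for w
  proof -
    have n: "norm (c * w / of_real d) < 1"
      using that assms False by (auto simp: norm_divide norm_mult field_simps)
    have "(\<lambda>k. of_real d powr a * ((a gchoose k) * (c * w / of_real d) ^ k)) sums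
           (of_real d powr a * (1 + c * w / of_real d) powr a)"
      by (intro sums_mult gen_binomial_complex n)
    also have "of_real d powr a * (1 + c * w / of_real d) powr a =
               (of_real d * (1 + c * w / of_real d)) powr a"
      using assms by (subst powr_times_real_left) auto
    also have "of_real d * (1 + c * w / of_real d) = of_real d + c * w"
      using assms by (simp add: field_simps)
    finally show ?thesis by (simp add: power_mult_distrib power_divide mult_ac)
  qed
  show ?thesis
  proof (rule has_fps_expansionI)
    have "\<forall>\<^sub>F w in nhds 0. w \<in> ball 0 (d / norm c)"
      using False assms by (intro eventually_nhds_in_open) auto
    then show "\<forall>\<^sub>F w in nhds 0. (\<lambda>k. fps_nth (Abs_fps (\<lambda>k. of_real d powr a * (a gchoose k) *
        (c / of_real d) ^ k)) k * w ^ k) sums (of_real d + c * w) powr a"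
      by eventually_elim (use * in auto)
  qed
qed

lemma jacobi_poly_explicit:
  assumes "-1 < x" "x < 1"
  shows "jacobi_poly (int n) \<alpha> \<beta> x =
           (\<Sum>s\<le>n. ((of_nat n + \<alpha>) gchoose (n - s)) * ((of_nat n + \<beta>) gchoose s) *
                  ((of_real x - 1) / 2) ^ s * ((of_real x + 1) / 2) ^ (n - s))"
proof -
  let ?a = "of_nat n + \<alpha>" and ?b = "of_nat n + \<beta>"
  let ?p = "complex_of_real (1 - x)" and ?q = "complex_of_real (1 + x)"
  let ?F = "Abs_fps (\<lambda>k. ?p powr ?a * (?a gchoose k) * (-1 / ?p) ^ k)"
  let ?G = "Abs_fps (\<lambda>k. ?q powr ?b * (?b gchoose k) * (1 / ?q) ^ k)"
  let ?C = "fps_const (1 / (?p powr \<alpha> * ?q powr \<beta>))"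
  have pq: "?p \<noteq> 0" "?q \<noteq> 0" using assms by (auto simp only: of_real_eq_0_iff)
  have "(\<lambda>w. (?p + (-1) * w) powr ?a * (?q + 1 * w) powr ?b * (1 / (?p powr \<alpha> * ?q powr \<beta>)))
           has_fps_expansion ?F * ?G * ?C"
    using assms by (intro has_fps_expansion_mult has_fps_expansion_powr_linear
                          has_fps_expansion_const) auto
  from residue_fps_expansion_over_power_at_0[OF this, of n]
  have "residue (jacobi_integrand n \<alpha> \<beta> x) 0 = fps_nth (?F * ?G * ?C) n"
    by (simp add: jacobi_integrand_def[abs_def] algebra_simps)
  also have "\<dots> = (\<Sum>k=0..n. ?p powr ?a * (?a gchoose k) * (-1 / ?p) ^ k *
      (?q powr ?b * (?b gchoose (n - k)) * (1 / ?q) ^ (n - k))) / (?p powr \<alpha> * ?q powr \<beta>)"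
    by (simp only: fps_mult_right_const_nth) (simp add: fps_mult_nth atLeast0AtMost)
  also have "\<dots> = (\<Sum>k=0..n. (?a gchoose k) * (?b gchoose (n - k)) * (-1) ^ k * ?p ^ (n - k) * ?q ^ k)"
    unfolding sum_divide_distrib
  proof (intro sum.cong refl)
    fix k assume "k \<in> {0..n}"
    then have k: "k \<le> n" by simp
    have 1: "?p powr ?a / ?p powr \<alpha> = ?p ^ n" "?q powr ?b / ?q powr \<beta> = ?q ^ n"
      using pq by (simp_all add: powr_add powr_nat' del: of_real_diff of_real_add)
    have "?p powr ?a * (?a gchoose k) * (-1 / ?p) ^ k *
      (?q powr ?b * (?b gchoose (n - k)) * (1 / ?q) ^ (n - k)) / (?p powr \<alpha> * ?q powr \<beta>) =
      (?p powr ?a / ?p powr \<alpha>) * (?q powr ?b / ?q powr \<beta>) * (?a gchoose k) * (?b gchoose (n - k)) *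
      ((-1) ^ k / (?p ^ k * ?q ^ (n - k)))"
      unfolding power_divide power_one by (simp add: mult_ac del: of_real_diff of_real_add)
    also have "\<dots> = (?a gchoose k) * (?b gchoose (n - k)) * (-1) ^ k * ?p ^ (n - k) * ?q ^ k"
    proof -
      have "?p ^ n = ?p ^ k * ?p ^ (n - k)" "?q ^ n = ?q ^ k * ?q ^ (n - k)"
        using k by (simp_all flip: power_add)
      then show ?thesis
        unfolding 1 using pq by (simp del: of_real_diff of_real_add)
    qed
    finally show "?p powr ?a * (?a gchoose k) * (-1 / ?p) ^ k *
      (?q powr ?b * (?b gchoose (n - k)) * (1 / ?q) ^ (n - k)) / (?p powr \<alpha> * ?q powr \<beta>) =
      (?a gchoose k) * (?b gchoose (n - k)) * (-1) ^ k * ?p ^ (n - k) * ?q ^ k" .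
  qed
  also have "\<dots> = (\<Sum>s=0..n. (?a gchoose (n - s)) * (?b gchoose s) * (-1) ^ (n - s) * ?p ^ s * ?q ^ (n - s))"
    by (rule sum.reindex_bij_witness[of _ "\<lambda>s. n - s" "\<lambda>s. n - s"]) auto
  finally have res: "residue (jacobi_integrand n \<alpha> \<beta> x) 0 = \<dots>" .
  have "jacobi_poly (int n) \<alpha> \<beta> x = (-1) ^ n / 2 ^ n * residue (jacobi_integrand n \<alpha> \<beta> x) 0"
  proof -
    have "winding_number (circlepath 0 ((1 - \<bar>x\<bar>) / 2)) 0 = 1"
      using assms by (intro winding_number_circlepath) auto
    then show ?thesis
      using jacobi_residue[OF assms _ _ jacobi_circle[OF assms], where n = n]
      by (simp add: jacobi_poly_def)
  qed
  also have "\<dots> = (\<Sum>s\<le>n. (?a gchoose (n - s)) * (?b gchoose s) *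
                  ((of_real x - 1) / 2) ^ s * ((of_real x + 1) / 2) ^ (n - s))"
    unfolding res sum_distrib_left atLeast0AtMost
  proof (intro sum.cong refl)
    fix s assume "s \<in> {..n}"
    then have s: "s \<le> n" by simp
    have e1: "((of_real x - 1) / 2) ^ s = (-1) ^ s * ?p ^ s / (2::complex) ^ s"
      by (simp add: power_divide flip: power_mult_distrib)
    have e2: "((of_real x + 1) / 2) ^ (n - s) = ?q ^ (n - s) / (2::complex) ^ (n - s)"
      by (simp add: power_divide add.commute)
    have e3: "(2::complex) ^ n = 2 ^ s * 2 ^ (n - s)" using s by (simp flip: power_add)
    have e4: "(-1::complex) ^ n * (-1) ^ (n - s) = (-1) ^ s"
      using s by (simp add: minus_one_power_iff)
    have "(-1) ^ n / 2 ^ n * ((?a gchoose (n - s)) * (?b gchoose s) * (-1) ^ (n - s) * ?p ^ s * ?q ^ (n - s)) =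
       ((-1) ^ n * (-1) ^ (n - s)) * ((?a gchoose (n - s)) * (?b gchoose s) * ?p ^ s * ?q ^ (n - s)) / 2 ^ n"
      by (simp del: of_real_diff of_real_add)
    also have "\<dots> = (?a gchoose (n - s)) * (?b gchoose s) *
                  ((of_real x - 1) / 2) ^ s * ((of_real x + 1) / 2) ^ (n - s)"
      unfolding e1 e2 e3 e4 by (simp del: of_real_diff of_real_add)
    finally show "(-1) ^ n / 2 ^ n * ((?a gchoose (n - s)) * (?b gchoose s) * (-1) ^ (n - s) * ?p ^ s * ?q ^ (n - s)) =
       (?a gchoose (n - s)) * (?b gchoose s) *
                  ((of_real x - 1) / 2) ^ s * ((of_real x + 1) / 2) ^ (n - s)" .
  qed
  finally show ?thesis .
qed

section \<open>Two-point Taylor coefficients\<close>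

text \<open>
  Two-point Taylor expansion at the points \<open>w0\<close> and \<open>-w0\<close>. The quotient is not defined at the
  two points themselves (division by zero yields zero), so that being analytic there means agreeing
  near them with an analytic function \<open>g\<close>.
\<close>

definition is_two_point_taylor ::
    "(complex \<Rightarrow> complex) \<Rightarrow> complex \<Rightarrow> (nat \<Rightarrow> complex) \<Rightarrow> (nat \<Rightarrow> complex) \<Rightarrow> bool" where
  "is_two_point_taylor f w0 A B \<longleftrightarrow>
     (\<forall>N. \<exists>g. g analytic_on {w0, -w0} \<and>
        (\<forall>z\<in>{w0, -w0}. \<forall>\<^sub>F w in at z.
           (f w - (\<Sum>k<N. (A k + B k * w) * (w\<^sup>2 - w0\<^sup>2) ^ k)) / (w\<^sup>2 - w0\<^sup>2) ^ N = g w))"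

definition two_point_taylor ::
    "(complex \<Rightarrow> complex) \<Rightarrow> complex \<Rightarrow> (nat \<Rightarrow> complex) \<times> (nat \<Rightarrow> complex)" where
  "two_point_taylor f w0 = (THE AB. is_two_point_taylor f w0 (fst AB) (snd AB))"

lemma two_point_step:
  assumes g: "g analytic_on {w0, -w0}" and w0: "w0 \<noteq> 0"
  shows "\<exists>a b g'. g' analytic_on {w0, -w0} \<and>
           (\<forall>z\<in>{w0, -w0}. \<forall>\<^sub>F w in at z. (g w - (a + b * w)) / (w\<^sup>2 - w0\<^sup>2) = g' w)"
proof -
  define a where "a = (g w0 + g (-w0)) / 2"
  define b where "b = (g w0 - g (-w0)) / (2 * w0)"
  define h where "h = (\<lambda>w. g w - (a + b * w))"
  have h: "h analytic_on {w0, -w0}"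
    unfolding h_def by (intro analytic_intros g)
  have h0: "h w0 = 0" "h (-w0) = 0"
    using w0 by (auto simp: h_def a_def b_def field_simps)
  define h1 where "h1 = (\<lambda>w. if w = w0 then deriv h w0 else h w / (w - w0))"
  have h1: "h1 analytic_on {w0, -w0}"
    by (rule pole_theorem_analytic_0[OF h, where a = w0])
       (auto simp: h1_def h0 intro!: exI[of _ 1])
  have h10: "h1 (-w0) = 0" using h0 w0 by (auto simp: h1_def)
  define h2 where "h2 = (\<lambda>w. if w = -w0 then deriv h1 (-w0) else h1 w / (w + w0))"
  have h2: "h2 analytic_on {w0, -w0}"
    by (rule pole_theorem_analytic_0[OF h1, where a = "-w0"])
       (auto simp: h2_def h10 intro!: exI[of _ 1] simp: add_eq_0_iff2)
  have *: "(g w - (a + b * w)) / (w\<^sup>2 - w0\<^sup>2) = h2 w" if "w \<noteq> w0" "w \<noteq> -w0" for w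
    using that by (simp add: h2_def h1_def h_def power2_eq_square square_diff_square_factored mult_ac)
  have "\<forall>\<^sub>F w in at z. (g w - (a + b * w)) / (w\<^sup>2 - w0\<^sup>2) = h2 w" for z
    using eventually_neq_at_within[of w0 z UNIV] eventually_neq_at_within[of "-w0" z UNIV]
    by eventually_elim (rule *)
  then show ?thesis using h2 by blast
qed

lemma is_two_point_taylor_exists:
  assumes f: "f analytic_on {w0, -w0}" and w0: "w0 \<noteq> 0"
  shows   "\<exists>A B. is_two_point_taylor f w0 A B"
proof -
  define P where "P = (\<lambda>g a b g'. g' analytic_on {w0, -w0} \<and>
           (\<forall>z\<in>{w0, -w0}. \<forall>\<^sub>F w in at z. (g w - (a + b * w)) / (w\<^sup>2 - w0\<^sup>2) = g' w))"
  have "\<forall>g. \<exists>t. g analytic_on {w0, -w0} \<longrightarrow> P g (fst t) (fst (snd t)) (snd (snd t))"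
    using two_point_step[OF _ w0] unfolding P_def by (auto intro: exI[of _ "(_, _, _)"])
  then obtain T where T: "\<And>g. g analytic_on {w0, -w0} \<Longrightarrow> P g (fst (T g)) (fst (snd (T g))) (snd (snd (T g)))"
    by metis
  define G where "G = (\<lambda>N. ((\<lambda>g. snd (snd (T g))) ^^ N) f)"
  define A where "A = (\<lambda>N. fst (T (G N)))"
  define B where "B = (\<lambda>N. fst (snd (T (G N))))"
  have G0: "G 0 = f" and GS: "G (Suc N) = snd (snd (T (G N)))" for N by (auto simp: G_def)
  have an: "G N analytic_on {w0, -w0}" for N
    by (induction N) (use f T in \<open>auto simp: G0 GS P_def\<close>)
  have step: "\<forall>\<^sub>F w in at z. (G N w - (A N + B N * w)) / (w\<^sup>2 - w0\<^sup>2) = G (Suc N) w"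
    if "z \<in> {w0, -w0}" for z N
    using T[OF an[of N]] that unfolding P_def A_def B_def GS by blast
  have *: "\<forall>\<^sub>F w in at z.
      (f w - (\<Sum>k<N. (A k + B k * w) * (w\<^sup>2 - w0\<^sup>2) ^ k)) / (w\<^sup>2 - w0\<^sup>2) ^ N = G N w"
    if z: "z \<in> {w0, -w0}" for z N
  proof (induction N)
    case 0
    then show ?case by (simp add: G0)
  next
    case (Suc N)
    have "\<forall>\<^sub>F w in at z. w \<noteq> w0" "\<forall>\<^sub>F w in at z. w \<noteq> -w0"
      by (auto intro: eventually_neq_at_within)
    then show ?case using Suc step[OF z, of N]
    proof eventually_elim
      case (elim w)
      define q where "q = w\<^sup>2 - w0\<^sup>2"
      define S where "S = (\<Sum>k<N. (A k + B k * w) * q ^ k)"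
      have q: "q \<noteq> 0" using elim(1,2) by (auto simp: power2_eq_iff q_def)
      have "(f w - S) / q ^ N = G N w" "(G N w - (A N + B N * w)) / q = G (Suc N) w"
        using elim(3,4) by (simp_all add: q_def S_def)
      then have "(f w - (S + (A N + B N * w) * q ^ N)) / q ^ Suc N = G (Suc N) w"
        using q by (simp add: divide_simps) (simp add: algebra_simps)
      then show ?case by (simp add: q_def S_def)
    qed
  qed
  have "is_two_point_taylor f w0 A B"
    unfolding is_two_point_taylor_def
  proof (intro allI)
    fix N
    show "\<exists>g. g analytic_on {w0, -w0} \<and> (\<forall>z\<in>{w0, -w0}. \<forall>\<^sub>F w in at z.
      (f w - (\<Sum>k<N. (A k + B k * w) * (w\<^sup>2 - w0\<^sup>2) ^ k)) / (w\<^sup>2 - w0\<^sup>2) ^ N = g w)"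
      by (intro exI[of _ "G N"] conjI ballI an *)
  qed
  then show ?thesis by blast
qed

lemma is_two_point_taylor_unique:
  assumes "is_two_point_taylor f w0 A B" "is_two_point_taylor f w0 A' B'" and w0: "w0 \<noteq> 0"
  shows   "A k = A' k \<and> B k = B' k"
proof (induction k rule: less_induct)
  case (less N)
  define S where "S = (\<lambda>w. \<Sum>k<N. (A k + B k * w) * (w\<^sup>2 - w0\<^sup>2) ^ k)"
  have S': "(\<Sum>k<N. (A' k + B' k * w) * (w\<^sup>2 - w0\<^sup>2) ^ k) = S w" for w
    unfolding S_def using less by (intro sum.cong) auto
  obtain g where g: "g analytic_on {w0, -w0}" "\<And>z. z \<in> {w0, -w0} \<Longrightarrow> \<forall>\<^sub>F w in at z.
      (f w - (S w + (A N + B N * w) * (w\<^sup>2 - w0\<^sup>2) ^ N)) / (w\<^sup>2 - w0\<^sup>2) ^ Suc N = g w"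
    using assms(1)[unfolded is_two_point_taylor_def, rule_format, of "Suc N"]
    unfolding sum.lessThan_Suc S_def by blast
  obtain g' where g': "g' analytic_on {w0, -w0}" "\<And>z. z \<in> {w0, -w0} \<Longrightarrow> \<forall>\<^sub>F w in at z.
      (f w - (S w + (A' N + B' N * w) * (w\<^sup>2 - w0\<^sup>2) ^ N)) / (w\<^sup>2 - w0\<^sup>2) ^ Suc N = g' w"
    using assms(2)[unfolded is_two_point_taylor_def, rule_format, of "Suc N"]
    unfolding sum.lessThan_Suc S' by blast
  define a where "a = A' N - A N"
  define b where "b = B' N - B N"
  have *: "a + b * z = 0" if z: "z \<in> {w0, -w0}" for z
  proof -
    have "\<forall>\<^sub>F w in at z. w \<noteq> w0" "\<forall>\<^sub>F w in at z. w \<noteq> -w0"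
      by (auto intro: eventually_neq_at_within)
    then have ev: "\<forall>\<^sub>F w in at z. (w\<^sup>2 - w0\<^sup>2) * (g w - g' w) = a + b * w"
      using g(2)[OF z] g'(2)[OF z]
    proof eventually_elim
      case (elim w)
      define q where "q = w\<^sup>2 - w0\<^sup>2"
      have q: "q \<noteq> 0" using elim(1,2) by (auto simp: power2_eq_iff q_def)
      show ?case using q unfolding elim(3,4)[symmetric] q_def[symmetric] a_def b_def
        by (simp add: divide_simps) (simp add: algebra_simps)
    qed
    have "isCont g z" "isCont g' z"
      using g(1) g'(1) z by (auto intro!: analytic_at_imp_isCont intro: analytic_on_subset)
    then have "((\<lambda>w. (w\<^sup>2 - w0\<^sup>2) * (g w - g' w)) \<longlongrightarrow> (z\<^sup>2 - w0\<^sup>2) * (g z - g' z)) (at z)"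
      unfolding isCont_def by (intro tendsto_intros)
    then have "((\<lambda>w. a + b * w) \<longlongrightarrow> 0) (at z)"
      using z by (subst (asm) tendsto_cong[OF ev]) auto
    moreover have "((\<lambda>w. a + b * w) \<longlongrightarrow> a + b * z) (at z)"
      by (intro tendsto_intros)
    ultimately show ?thesis using LIM_unique by blast
  qed
  have "a + b * w0 = 0" "a - b * w0 = 0" using *[of w0] *[of "-w0"] by auto
  then have "b * w0 = 0" "a = 0" by algebra+
  then show ?case using w0 by (auto simp: a_def b_def)
qed

lemma is_two_point_taylor_two_point_taylor:
  assumes "f analytic_on {w0, -w0}" "w0 \<noteq> 0"
  shows   "is_two_point_taylor f w0 (fst (two_point_taylor f w0)) (snd (two_point_taylor f w0))"
proof -
  obtain A B where "is_two_point_taylor f w0 A B"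
    using is_two_point_taylor_exists[OF assms] by blast
  then have "\<exists>!AB. is_two_point_taylor f w0 (fst AB) (snd AB)"
    using is_two_point_taylor_unique[OF _ _ assms(2)]
    by (intro ex1I[of _ "(A, B)"]) (auto simp: prod_eq_iff fun_eq_iff)
  then show ?thesis unfolding two_point_taylor_def by (rule theI')
qed

section \<open>The expansion\<close>

definition jacobi_f :: "complex \<Rightarrow> complex \<Rightarrow> real \<Rightarrow> complex \<Rightarrow> complex" where
  "jacobi_f \<alpha> \<beta> x w =
     of_real (1 - x) powr (-\<alpha> - 1/2) * of_real (1 + x) powr (-\<beta> - 1/2) *
     (1 - w - of_real x) powr (\<alpha> + 1/2) * (1 + w + of_real x) powr (\<beta> + 1/2)"

definition w0 :: "real \<Rightarrow> complex" where
  "w0 x = \<i> * of_real (sqrt (1 - x\<^sup>2))"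

definition coeff_A :: "complex \<Rightarrow> complex \<Rightarrow> real \<Rightarrow> nat \<Rightarrow> complex" where
  "coeff_A \<alpha> \<beta> x = fst (two_point_taylor (jacobi_f \<alpha> \<beta> x) (w0 x))"

definition coeff_B :: "complex \<Rightarrow> complex \<Rightarrow> real \<Rightarrow> nat \<Rightarrow> complex" where
  "coeff_B \<alpha> \<beta> x = snd (two_point_taylor (jacobi_f \<alpha> \<beta> x) (w0 x))"

definition Phi :: "nat \<Rightarrow> real \<Rightarrow> nat \<Rightarrow> complex" where
  "Phi k x n =
     (\<Sum>j\<le>k. of_nat (k choose j) * (of_real (1 - x\<^sup>2) ^ (k + j) / 4 ^ j) *
        jacobi_poly (int n - 2 * int j) (2 * of_nat j - 1/2) (2 * of_nat j - 1/2) x)"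

definition Psi :: "nat \<Rightarrow> real \<Rightarrow> nat \<Rightarrow> complex" where
  "Psi k x n =
     - (1/2) * of_real (1 - x\<^sup>2) *
     (\<Sum>j\<le>k. of_nat (k choose j) * (of_real (1 - x\<^sup>2) ^ (k + j) / 4 ^ j) *
        jacobi_poly (int n - 1 - 2 * int j) (2 * of_nat j + 1/2) (2 * of_nat j + 1/2) x)"

lemma coeffs_well_defined:
  assumes "-1 < x" "x < 1"
  shows   "is_two_point_taylor (jacobi_f \<alpha> \<beta> x) (w0 x) (coeff_A \<alpha> \<beta> x) (coeff_B \<alpha> \<beta> x)"
proof -
  have "x\<^sup>2 < 1" using assms by (simp add: abs_square_less_1)
  then have nz: "w0 x \<noteq> 0" and im: "Im (w0 x) \<noteq> 0" by (auto simp: w0_def)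
  have *: "w0 x \<in> cut_plane x" "-w0 x \<in> cut_plane x"
    using im by (auto simp: mem_cut_plane_iff complex_nonpos_Reals_iff)
  have "jacobi_f \<alpha> \<beta> x holomorphic_on cut_plane x"
    unfolding jacobi_f_def by (intro holomorphic_intros) (auto simp: mem_cut_plane_iff)
  then have "jacobi_f \<alpha> \<beta> x analytic_on cut_plane x"
    using open_cut_plane by (simp add: analytic_on_open)
  then have "jacobi_f \<alpha> \<beta> x analytic_on {w0 x, -w0 x}"
    by (rule analytic_on_subset) (use * in auto)
  then show ?thesis
    unfolding coeff_A_def coeff_B_def using nz by (rule is_two_point_taylor_two_point_taylor)
qed

end

theory Submission
  imports Defs
begin

text \<open>
  Write \<open>f\<close> for \<open>jacobi_f \<alpha> \<beta> x\<close>. Dividing the generating function of the Jacobi polynomials by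
  \<open>f\<close> leaves the same generating function with parameters \<open>-1/2\<close>, so \<open>P_n\<close> is a finite linear
  combination of the Taylor coefficients of \<open>f\<close> at 0, with weights \<open>ultra x n i\<close> that depend
  neither on \<open>\<alpha>\<close> nor on \<open>\<beta>\<close>. Applied to \<open>(w\<^sup>2 + 1 - x\<^sup>2) ^ k\<close> and to \<open>w * (w\<^sup>2 + 1 - x\<^sup>2) ^ k\<close> this
  functional yields \<open>\<Phi>_k\<close> and \<open>\<Psi>_k\<close>. The point 0 lies in the domain of convergence
  \<open>\<bar>w\<^sup>2 + 1 - x\<^sup>2\<bar> < 2 * (1 - \<bar>x\<bar>)\<close> of the two-point expansion because \<open>1 - x\<^sup>2 < 2 * (1 - \<bar>x\<bar>)\<close>,
  hence the functional may be applied termwise.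

  For the decay in \<open>n\<close>, the differential equation of the generating function is a three-term
  recurrence in \<open>i\<close> for the weights. It expresses \<open>n\<close> times the functional of order \<open>k + 1\<close>
  through those of orders \<open>k\<close> and \<open>k - 1\<close> with coefficients independent of \<open>n\<close>, so two orders
  gain one power of \<open>n\<close>. The start of the induction is the boundedness of the weights: up to the
  factor \<open>(2 * n + 1) / (2 * n + 2)\<close>, passing from \<open>n\<close> to \<open>n + 1\<close> acts as an orthogonal map on the
  first two of them.
\<close>

section \<open>Generating functions\<close>

definition binomial_fps :: "complex \<Rightarrow> complex \<Rightarrow> complex fps" where
  "binomial_fps a c = Abs_fps (\<lambda>k. (a gchoose k) * c ^ k)"

lemma binomial_fps_nth [simp]: "fps_nth (binomial_fps a c) k = (a gchoose k) * c ^ k"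
  by (simp add: binomial_fps_def)

lemma binomial_fps_add: "binomial_fps (a + b) c = binomial_fps a c * binomial_fps b c"
proof (rule fps_ext)
  fix n
  have "fps_nth (binomial_fps a c * binomial_fps b c) n =
      (\<Sum>i=0..n. (a gchoose i) * (b gchoose (n - i))) * c ^ n"
    unfolding fps_mult_nth sum_distrib_right
    by (intro sum.cong refl) (auto simp: mult_ac simp flip: power_add)
  then show "fps_nth (binomial_fps (a + b) c) n = fps_nth (binomial_fps a c * binomial_fps b c) n"
    by (simp add: gbinomial_Vandermonde)
qed

lemma binomial_fps_1: "binomial_fps 1 c = 1 + fps_const c * fps_X"
proof (rule fps_ext)
  fix n
  have "(1::complex) gchoose n = of_nat (1 choose n)"
    using binomial_gbinomial[of 1 n, where 'a = complex] by simp
  then show "fps_nth (binomial_fps 1 c) n = fps_nth (1 + fps_const c * fps_X) n"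
    by (cases n; cases "n - 1") (auto simp: fps_X_def binomial_eq_0)
qed

lemma binomial_fps_deriv:
  "(1 + fps_const c * fps_X) * fps_deriv (binomial_fps a c) = fps_const (a * c) * binomial_fps a c"
proof (rule fps_ext)
  fix n
  have "fps_nth ((1 + fps_const c * fps_X) * fps_deriv (binomial_fps a c)) n =
     (of_nat n * (a gchoose n) + of_nat (Suc n) * (a gchoose Suc n)) * c ^ Suc n"
    by (cases n) (simp_all add: ring_distribs mult.assoc flip: fps_mult_fps_X_commute)
  also have "\<dots> = fps_nth (fps_const (a * c) * binomial_fps a c) n"
    using gbinomial_mult_1[of a n] by (simp add: mult_ac)
  finally show "fps_nth ((1 + fps_const c * fps_X) * fps_deriv (binomial_fps a c)) n =
    fps_nth (fps_const (a * c) * binomial_fps a c) n" .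
qed

text \<open>The explicit sum is a Cauchy product. The exponents contain \<open>n\<close> too, so the
  series itself changes with the index that is read off.\<close>

lemma jacobi_poly_eq_fps_nth:
  assumes "-1 < x" "x < 1"
  shows "jacobi_poly (int n) \<alpha> \<beta> x =
    fps_nth (binomial_fps (of_nat n + \<alpha>) ((of_real x + 1) / 2) *
             binomial_fps (of_nat n + \<beta>) ((of_real x - 1) / 2)) n"
proof -
  have "fps_nth (binomial_fps (of_nat n + \<alpha>) ((of_real x + 1) / 2) *
             binomial_fps (of_nat n + \<beta>) ((of_real x - 1) / 2)) n =
    (\<Sum>i=0..n. (of_nat n + \<alpha> gchoose i) * ((of_real x + 1) / 2) ^ i *
       ((of_nat n + \<beta> gchoose (n - i)) * ((of_real x - 1) / 2) ^ (n - i)))"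
    by (simp add: fps_mult_nth)
  also have "\<dots> = jacobi_poly (int n) \<alpha> \<beta> x"
    unfolding jacobi_poly_explicit[OF assms] atLeast0AtMost
    by (rule sum.reindex_bij_witness[of _ "\<lambda>s. n - s" "\<lambda>s. n - s"]) (auto simp: mult_ac)
  finally show ?thesis ..
qed

section \<open>The series with both parameters -1/2, the weights and their recurrences\<close>

definition ultra_fps :: "real \<Rightarrow> nat \<Rightarrow> complex fps" where
  "ultra_fps x n = binomial_fps (of_nat n - 1/2) ((of_real x + 1) / 2) *
                   binomial_fps (of_nat n - 1/2) ((of_real x - 1) / 2)"

lemma ultra_fps_Suc:
  "ultra_fps x (Suc n) =
     (1 + fps_const (of_real x) * fps_X + fps_const (- of_real (1 - x\<^sup>2) / 4) * fps_X ^ 2) * ultra_fps x n"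
proof -
  define p q where "p = (complex_of_real x + 1) / 2" and "q = (complex_of_real x - 1) / 2"
  have e: "complex_of_real x = p + q" "- complex_of_real (1 - x\<^sup>2) / 4 = p * q"
    by (simp_all add: p_def q_def field_simps power2_eq_square)
  have "of_nat (Suc n) - 1/2 = 1 + (of_nat n - 1/2 :: complex)" by simp
  then show ?thesis
    unfolding ultra_fps_def p_def[symmetric] q_def[symmetric] unfolding e
    by (simp only: binomial_fps_add binomial_fps_1 fps_const_add[symmetric] fps_const_mult[symmetric])
       (simp add: algebra_simps power2_eq_square del: fps_const_add fps_const_mult)
qed

text \<open>The series G is the power n - 1/2 of the quadratic polynomial Q in front, so Q G' = (n -
  1/2) Q' G. The proof combines the equations of the two linear factors of Q.\<close>

lemma ultra_fps_deriv:
  "(1 + fps_const (of_real x) * fps_X + fps_const (- of_real (1 - x\<^sup>2) / 4) * fps_X ^ 2) *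
     fps_deriv (ultra_fps x n) =
   fps_const (of_nat n - 1/2) * (fps_const (of_real x) + fps_const (- of_real (1 - x\<^sup>2) / 2) * fps_X) * ultra_fps x n"
proof -
  define p q where "p = (complex_of_real x + 1) / 2" and "q = (complex_of_real x - 1) / 2"
  have e: "complex_of_real x = p + q" "- complex_of_real (1 - x\<^sup>2) / 4 = p * q"
     "- complex_of_real (1 - x\<^sup>2) / 2 = 2 * p * q"
    by (simp_all add: p_def q_def field_simps power2_eq_square)
  define a where "a = (of_nat n - 1/2 :: complex)"
  define P Q where "P = fps_const p" and "Q = fps_const q"
  define F G where "F = binomial_fps a p" and "G = binomial_fps a q"
  have F: "(1 + P * fps_X) * fps_deriv F = fps_const a * P * F"
   and G: "(1 + Q * fps_X) * fps_deriv G = fps_const a * Q * G"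
    using binomial_fps_deriv[of p a] binomial_fps_deriv[of q a] by (simp_all add: P_def Q_def F_def G_def)
  have "(1 + (P + Q) * fps_X + P * Q * fps_X ^ 2) * (fps_deriv F * G + F * fps_deriv G) =
     (1 + Q * fps_X) * G * ((1 + P * fps_X) * fps_deriv F) + (1 + P * fps_X) * F * ((1 + Q * fps_X) * fps_deriv G)"
    by (simp add: algebra_simps power2_eq_square)
  also have "\<dots> = fps_const a * ((P + Q) + (P * Q + P * Q) * fps_X) * (F * G)"
    unfolding F G by (simp add: algebra_simps)
  finally show ?thesis
    unfolding ultra_fps_def p_def[symmetric] q_def[symmetric] a_def[symmetric] F_def[symmetric] G_def[symmetric]
    unfolding e by (simp add: P_def Q_def algebra_simps)
qed

lemma ultra_fps_nth_Suc:
  "fps_nth (ultra_fps x (Suc n)) (Suc j) = fps_nth (ultra_fps x n) (Suc j) + of_real x * fps_nth (ultra_fps x n) j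
     - of_real (1 - x\<^sup>2) / 4 * (if j = 0 then 0 else fps_nth (ultra_fps x n) (j - 1))"
  "fps_nth (ultra_fps x (Suc n)) 0 = fps_nth (ultra_fps x n) 0"
  unfolding ultra_fps_Suc
  by (cases j; simp add: ring_distribs mult.assoc power2_eq_square del: of_real_diff)+


text \<open>Coefficients at X^j in \<open>ultra_fps_deriv\<close>; 2n - j is 2 (n - 1/2) - (j - 1).
  At j = 0 the explicit 0 guards against truncated subtraction.\<close>

lemma ultra_fps_nth_rec:
  "of_nat (Suc j) * fps_nth (ultra_fps x n) (Suc j) = of_real x * (of_nat n - 1/2 - of_nat j) * fps_nth (ultra_fps x n) j
     - of_real (1 - x\<^sup>2) / 4 * (2 * of_nat n - of_nat j) * (if j = 0 then 0 else fps_nth (ultra_fps x n) (j - 1))"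
proof -
  define X T where "X = complex_of_real x" and "T = complex_of_real (1 - x\<^sup>2)"
  define g where "g = fps_nth (ultra_fps x n)"
  have *: "fps_nth ((1 + fps_const X * fps_X + fps_const (- T / 4) * fps_X ^ 2) * fps_deriv (ultra_fps x n)) j =
      fps_nth (fps_const (of_nat n - 1/2) * (fps_const X + fps_const (- T / 2) * fps_X) * ultra_fps x n) j"
    using ultra_fps_deriv[of x n] by (simp only: X_def T_def)
  have "of_nat (Suc j) * g (Suc j) = X * (of_nat n - 1/2 - of_nat j) * g j
     - T / 4 * (2 * of_nat n - of_nat j) * (if j = 0 then 0 else g (j - 1))"
  proof (cases j)
    case 0
    then show ?thesis using * by (simp add: ring_distribs mult.assoc power2_eq_square g_def)
  next
    case (Suc i)
    define a S where "a = (of_nat n - 1/2 :: complex)" and "S = T / 4"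
    have S: "T / 4 = S" "- T / 2 = - 2 * S" "of_nat n - 1/2 = a" "2 * of_nat n - of_nat j = 2 * a + 1 - of_nat j"
      "- T / 4 = - S"
      by (simp_all add: a_def S_def)
    have "of_nat (Suc j) * g (Suc j) + X * (of_nat j * g j) - S * (of_nat i * g i) =
        a * (X * g j - 2 * S * g i)"
      using *[unfolded S] Suc
      by (cases i) (simp_all add: ring_distribs mult.assoc power2_eq_square g_def[symmetric], simp add: algebra_simps)
    moreover have "of_nat j = (of_nat i + 1 :: complex)" using Suc by simp
    ultimately have "of_nat (Suc j) * g (Suc j) = X * (a - of_nat j) * g j - S * (2 * a + 1 - of_nat j) * g i"
      by algebra
    then show ?thesis using S Suc by simp
  qed
  then show ?thesis by (simp only: X_def T_def g_def)
qed

text \<open>The weight in P_n of the Taylor coefficient of f with index m. The power rescales the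
  argument of f. For m > n truncated subtraction would otherwise select the constant
  coefficient.\<close>

definition ultra :: "real \<Rightarrow> nat \<Rightarrow> nat \<Rightarrow> complex" where
  "ultra x n m = (if m \<le> n then (- of_real (1 - x\<^sup>2) / 2) ^ m * fps_nth (ultra_fps x n) (n - m) else 0)"

lemma ultra_eq_0: "m > n \<Longrightarrow> ultra x n m = 0"
  by (simp add: ultra_def)

text \<open>The exponent n - 1/2 is the degree n - m plus the parameter m - 1/2. For m > n both
  sides are 0, on the right because the degree is negative.\<close>

lemma ultra_eq_jacobi_poly:
  assumes "-1 < x" "x < 1"
  shows "ultra x n m = (- of_real (1 - x\<^sup>2) / 2) ^ m *
    jacobi_poly (int n - int m) (of_nat m - 1/2) (of_nat m - 1/2) x"
proof (cases "m \<le> n")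
  case True
  then have "of_nat (n - m) + (of_nat m - 1/2) = (of_nat n - 1/2 :: complex)"
    by (simp add: of_nat_diff)
  with True show ?thesis
    using jacobi_poly_eq_fps_nth[OF assms, of "n - m"]
    by (simp add: ultra_def ultra_fps_def of_nat_diff)
qed (simp add: ultra_def jacobi_poly_def)

text \<open>This is \<open>ultra_fps_nth_rec\<close> at index n - m - 1, rescaled. At m = n the
  factor n - m and the two higher weights vanish; beyond that all weights do.\<close>

lemma ultra_rec:
  "of_nat (n + Suc m) * ultra x n (m + 2) + of_real x * of_nat (2 * m + 1) * ultra x n (Suc m) +
    of_real (1 - x\<^sup>2) * (of_nat n - of_nat m) * ultra x n m = 0"
proof (cases "m < n")
  case True
  define T where "T = complex_of_real (1 - x\<^sup>2) / 4"
  define s where "s = - 2 * T"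
  define g where "g = fps_nth (ultra_fps x n)"
  define j where "j = n - Suc m"
  define X where "X = complex_of_real x"
  have n: "of_nat n = (of_nat j + of_nat m + 1 :: complex)"
    using True by (auto simp: j_def of_nat_diff)
  have T: "complex_of_real (1 - x\<^sup>2) = 4 * T" "- complex_of_real (1 - x\<^sup>2) / 2 = s"
    by (simp_all add: T_def s_def)
  have u: "ultra x n m = s ^ m * g (Suc j)" "ultra x n (Suc m) = s ^ Suc m * g j"
    using True unfolding ultra_def T(2) by (simp_all add: g_def j_def Suc_diff_Suc)
  have u2: "ultra x n (m + 2) = s ^ (m + 2) * (if j = 0 then 0 else g (j - 1))"
    using True unfolding ultra_def T(2) by (auto simp: g_def j_def)
  define h where "h = (if j = 0 then 0 else g (j - 1))"
  have "of_nat (Suc j) * g (Suc j) = X * (of_nat n - 1/2 - of_nat j) * g j - T * (2 * of_nat n - of_nat j) * h"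
    using ultra_fps_nth_rec[of j x n] unfolding g_def[symmetric] h_def T_def X_def .
  then have "(of_nat j + 1) * g (Suc j) = X * (of_nat m + 1 / 2) * g j - T * (of_nat j + 2 * of_nat m + 2) * h"
    by (simp add: n algebra_simps)
  from arg_cong[OF this, of "\<lambda>z. 2 * z"]
  have "2 * (of_nat j + 1) * g (Suc j) = X * (2 * of_nat m + 1) * g j + s * (of_nat j + 2 * of_nat m + 2) * h"
    by (simp add: s_def algebra_simps)
  then have "s * s ^ m * (X * (2 * of_nat m + 1) * g j + s * (of_nat j + 2 * of_nat m + 2) * h
      - 2 * (of_nat j + 1) * g (Suc j)) = 0"
    by simp
  moreover have "complex_of_real (1 - x\<^sup>2) = - 2 * s" using T(1) by (simp add: s_def)
  ultimately show ?thesis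
    unfolding u u2 X_def[symmetric] h_def[symmetric]
    by (simp add: n algebra_simps del: of_real_diff)
next
  case False
  then show ?thesis by (cases "m = n") (simp_all add: ultra_def)
qed

text \<open>The new weight involves the coefficient of index n + 1, which is no weight for n. The
  recurrence at index n eliminates it.\<close>

lemma ultra_Suc_0:
  "ultra x (Suc n) 0 = of_nat (2 * n + 1) / of_nat (2 * n + 2) * (of_real x * ultra x n 0 + ultra x n 1)"
proof -
  define X T where "X = complex_of_real x" and "T = complex_of_real (1 - x\<^sup>2) / 4"
  define g where "g = fps_nth (ultra_fps x n)"
  define h where "h = (if n = 0 then 0 else g (n - 1))"
  have nz: "of_nat n + 1 \<noteq> (0::complex)" by (metis of_nat_Suc of_nat_neq_0 add.commute)
  have nz2: "2 + 2 * of_nat n \<noteq> (0::complex)" using nz by (metis add.commute distrib_left mult_1_right mult_eq_0_iff zero_neq_numeral)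
  have "2 * (of_nat n + 1) * g (Suc n) = - X * g n - 2 * T * of_nat n * h"
  proof -
    have "of_nat (Suc n) * g (Suc n) = X * (of_nat n - 1/2 - of_nat n) * g n - T * (2 * of_nat n - of_nat n) * h"
      using ultra_fps_nth_rec[of n x n] unfolding g_def[symmetric] h_def T_def X_def .
    from arg_cong[OF this, of "\<lambda>z. 2 * z"] show ?thesis by (simp add: algebra_simps)
  qed
  moreover have "ultra x (Suc n) 0 = g (Suc n) + X * g n - T * h"
    using ultra_fps_nth_Suc(1)[of x n n] unfolding ultra_def g_def h_def T_def X_def by simp
  moreover have "ultra x n 0 = g n" "ultra x n 1 = - 2 * T * h"
    by (auto simp: ultra_def g_def h_def T_def)
  ultimately have "2 * (of_nat n + 1) * ultra x (Suc n) 0 = (2 * of_nat n + 1) * (X * ultra x n 0 + ultra x n 1)"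
    by algebra
  then show ?thesis using nz nz2 by (simp add: X_def eq_divide_eq algebra_simps)
qed

lemma ultra_Suc_Suc:
  "ultra x (Suc n) (Suc m) = - of_real (1 - x\<^sup>2) / 2 * ultra x n m + of_real x * ultra x n (Suc m) + ultra x n (m + 2) / 2"
proof (cases "m < n")
  case True
  define T where "T = complex_of_real (1 - x\<^sup>2) / 4"
  define s where "s = - 2 * T"
  define g where "g = fps_nth (ultra_fps x n)"
  define j where "j = n - Suc m"
  have n: "n - m = Suc j" using True by (simp add: j_def)
  have T: "complex_of_real (1 - x\<^sup>2) = 4 * T" "- complex_of_real (1 - x\<^sup>2) / 2 = s"
    by (simp_all add: T_def s_def)
  define h where "h = (if j = 0 then 0 else g (j - 1))"
  have u: "ultra x n m = s ^ m * g (Suc j)" "ultra x n (Suc m) = s ^ Suc m * g j"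
    using True unfolding ultra_def T(2) by (simp_all add: g_def j_def Suc_diff_Suc)
  have u2: "ultra x n (m + 2) = s ^ (m + 2) * h"
    using True unfolding ultra_def T(2) by (auto simp: g_def j_def h_def)
  have "ultra x (Suc n) (Suc m) = s ^ Suc m * (g (Suc j) + of_real x * g j - T * h)"
    using True ultra_fps_nth_Suc(1)[of x n j]
    unfolding ultra_def T(2) T_def[symmetric] by (simp add: n g_def[symmetric] h_def)
  then show ?thesis unfolding u u2 T by (simp add: s_def algebra_simps)
next
  case False
  then show ?thesis using ultra_fps_nth_Suc(2)[of x n] by (cases "m = n") (simp_all add: ultra_def)
qed

text \<open>\<open>ultra_Suc_Suc\<close> brings in the weight of index 2, which
  \<open>ultra_rec\<close> at m = 0 eliminates. The scalar factor is the same as in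
  \<open>ultra_Suc_0\<close>.\<close>

lemma ultra_Suc_1:
  "ultra x (Suc n) 1 =
    of_nat (2 * n + 1) / of_nat (2 * n + 2) * (of_real x * ultra x n 1 - of_real (1 - x\<^sup>2) * ultra x n 0)"
proof -
  have nz: "of_nat n + 1 \<noteq> (0::complex)" by (metis of_nat_Suc of_nat_neq_0 add.commute)
  have nz2: "2 + 2 * of_nat n \<noteq> (0::complex)" using nz by (metis add.commute distrib_left mult_1_right mult_eq_0_iff zero_neq_numeral)
  define X S where "X = complex_of_real x" and "S = complex_of_real (1 - x\<^sup>2)"
  have "(of_nat n + 1) * ultra x n 2 + X * ultra x n 1 + S * of_nat n * ultra x n 0 = 0"
    using ultra_rec[of n 0] by (simp add: X_def S_def numeral_2_eq_2 add.commute)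
  moreover have "2 * ultra x (Suc n) 1 = - S * ultra x n 0 + 2 * X * ultra x n 1 + ultra x n 2"
    using ultra_Suc_Suc[of x n 0] by (simp add: X_def S_def numeral_2_eq_2)
  ultimately have "2 * (of_nat n + 1) * ultra x (Suc n) 1 = (2 * of_nat n + 1) * (X * ultra x n 1 - S * ultra x n 0)"
    by algebra
  then show ?thesis using nz nz2 unfolding X_def[symmetric] S_def[symmetric]
    by (simp add: eq_divide_eq algebra_simps)
qed


section \<open>Boundedness of the weights in n\<close>

lemma ultra_energy_decreasing:
  assumes "-1 < x" "x < 1"
  shows "(1 - x\<^sup>2) * (norm (ultra x (Suc n) 0))\<^sup>2 + (norm (ultra x (Suc n) 1))\<^sup>2 \<le>
         (1 - x\<^sup>2) * (norm (ultra x n 0))\<^sup>2 + (norm (ultra x n 1))\<^sup>2"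
proof -
  define \<rho> where "\<rho> = real (2 * n + 1) / real (2 * n + 2)"
  define a b where "a = ultra x n 0" and "b = ultra x n 1"
  have \<rho>: "of_nat (2 * n + 1) / of_nat (2 * n + 2) = complex_of_real \<rho>" by (simp add: \<rho>_def)
  have x: "x\<^sup>2 < 1" using assms by (simp add: abs_square_less_1)
  have "\<rho>\<^sup>2 \<le> 1" by (simp add: \<rho>_def power_le_one)
  have "(1 - x\<^sup>2) * (norm (ultra x (Suc n) 0))\<^sup>2 + (norm (ultra x (Suc n) 1))\<^sup>2 =
     \<rho>\<^sup>2 * ((1 - x\<^sup>2) * (norm (of_real x * a + b))\<^sup>2 + (norm (of_real x * b - of_real (1 - x\<^sup>2) * a))\<^sup>2)"
    unfolding ultra_Suc_0 ultra_Suc_1 \<rho> norm_mult power_mult_distrib a_def[symmetric] b_def[symmetric]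
    by (simp add: algebra_simps del: of_real_diff)
  \<comment> \<open>In the coordinates (sqrt (1 - x^2) a, b) the map is the rotation with cosine x
    and sine sqrt (1 - x^2).\<close>
  also have "(1 - x\<^sup>2) * (norm (of_real x * a + b))\<^sup>2 + (norm (of_real x * b - of_real (1 - x\<^sup>2) * a))\<^sup>2 =
      (1 - x\<^sup>2) * (norm a)\<^sup>2 + (norm b)\<^sup>2"
    unfolding cmod_power2 by (simp add: algebra_simps power2_eq_square)
  also have "\<rho>\<^sup>2 * \<dots> \<le> 1 * \<dots>"
    using x \<open>\<rho>\<^sup>2 \<le> 1\<close> by (intro mult_right_mono) auto
  finally show ?thesis by (simp add: a_def b_def)
qed

text \<open>The energy bounds the weights 0 and 1 uniformly in n, since 1 - x^2 > 0. From there
  \<open>ultra_rec\<close> climbs in m: its leading factor n + m + 1 dominates the other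
  coefficients up to a constant.\<close>

lemma ultra_bounded:
  assumes "-1 < x" "x < 1"
  shows "\<exists>C. \<forall>n. norm (ultra x n m) \<le> C"
proof -
  have x: "x\<^sup>2 < 1" using assms by (simp add: abs_square_less_1)
  define K where "K = (1 - x\<^sup>2) * (norm (ultra x 0 0))\<^sup>2 + (norm (ultra x 0 1))\<^sup>2"
  have K: "(1 - x\<^sup>2) * (norm (ultra x n 0))\<^sup>2 + (norm (ultra x n 1))\<^sup>2 \<le> K" for n
    by (induction n) (use ultra_energy_decreasing[OF assms] in \<open>auto simp: K_def intro: order_trans\<close>)
  have 0: "\<exists>C. \<forall>n. norm (ultra x n 0) \<le> C"
  proof (intro exI allI)
    fix n
    have "(1 - x\<^sup>2) * (norm (ultra x n 0))\<^sup>2 \<le> K"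
      using K[of n] by (smt (verit) zero_le_power2)
    then have "(norm (ultra x n 0))\<^sup>2 \<le> K / (1 - x\<^sup>2)" using x by (simp add: field_simps)
    then show "norm (ultra x n 0) \<le> sqrt (K / (1 - x\<^sup>2))" by (rule real_le_rsqrt)
  qed
  have 1: "\<exists>C. \<forall>n. norm (ultra x n 1) \<le> C"
  proof (intro exI allI)
    fix n
    have "0 \<le> (1 - x\<^sup>2) * (norm (ultra x n 0))\<^sup>2" using x by simp
    with K[of n] have "(norm (ultra x n 1))\<^sup>2 \<le> K" by linarith
    then show "norm (ultra x n 1) \<le> sqrt K" by (rule real_le_rsqrt)
  qed
  show ?thesis
  proof (induction m rule: less_induct)
    case (less m)
    consider "m = 0" | "m = 1" | i where "m = i + 2"
      by (metis One_nat_def add_2_eq_Suc' not0_implies_Suc)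
    then show ?case
    proof cases
      case 3
      obtain C D where C: "\<And>n. norm (ultra x n i) \<le> C" and D: "\<And>n. norm (ultra x n (Suc i)) \<le> D"
        using less.IH[of i] less.IH[of "Suc i"] 3 by auto
      have "norm (ultra x n m) \<le> (2 * real i + 1) * D + C" for n
      proof -
        have neg: "a = - (b + c)" if "a + b + c = 0" for a b c :: complex
          using that by (metis add.assoc eq_neg_iff_add_eq_0)
        have p: "0 < real n + real i + 1" by simp
        have "of_nat (n + Suc i) * ultra x n m =
           - (of_real x * of_nat (2 * i + 1) * ultra x n (Suc i) + of_real ((1 - x\<^sup>2) * (real n - real i)) * ultra x n i)"
          using neg[OF ultra_rec[of n i]] by (simp add: 3)
        then have "norm (of_nat (n + Suc i) * ultra x n m) \<le>
            norm (of_real x * of_nat (2 * i + 1) * ultra x n (Suc i)) + norm (of_real ((1 - x\<^sup>2) * (real n - real i)) * ultra x n i)"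
          by (simp only: norm_minus_cancel norm_triangle_ineq)
        also have "norm (of_real x * of_nat (2 * i + 1) * ultra x n (Suc i)) =
            (\<bar>x\<bar> * (2 * real i + 1)) * norm (ultra x n (Suc i))"
          by (simp only: norm_mult norm_of_real norm_of_nat) simp
        also have "\<dots> \<le> ((real n + real i + 1) * (2 * real i + 1)) * D"
          using assms by (intro mult_mono D mult_right_mono) auto
        also have "norm (of_real ((1 - x\<^sup>2) * (real n - real i)) * ultra x n i) =
            ((1 - x\<^sup>2) * \<bar>real n - real i\<bar>) * norm (ultra x n i)"
          using x by (simp add: norm_mult abs_mult del: of_real_diff of_real_mult)
        also have "\<dots> \<le> (1 * (real n + real i + 1)) * C"
          using x by (intro mult_mono C) auto
        finally have "(real n + real i + 1) * norm (ultra x n m) \<le> (real n + real i + 1) * ((2 * real i + 1) * D + C)"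
          by (simp add: norm_mult algebra_simps del: of_nat_Suc of_nat_add) (simp add: algebra_simps)
        then show ?thesis using p by (rule mult_left_le_imp_le)
      qed
      then show ?thesis by blast
    qed (use 0 1 in auto)
  qed
qed

section \<open>P_n as a finite combination of Taylor coefficients of f at 0\<close>

lemma jacobi_f_has_fps_expansion:
  assumes "-1 < x" "x < 1"
  shows "jacobi_f \<alpha> \<beta> x has_fps_expansion
    binomial_fps (\<alpha> + 1/2) (- 1 / of_real (1 - x)) * binomial_fps (\<beta> + 1/2) (1 / of_real (1 + x))"
proof -
  define p q where "p = 1 - x" and "q = 1 + x"
  have pq: "p > 0" "q > 0" using assms by (auto simp: p_def q_def)
  have B: "Abs_fps (\<lambda>k. of_real d powr a * (a gchoose k) * (c / of_real d) ^ k) =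
      fps_const (of_real d powr a) * binomial_fps a (c / of_real d)" for d :: real and a c
    by (simp add: fps_eq_iff mult.assoc)
  have E: "(\<lambda>w. of_real d powr - a * (of_real d + c * w) powr a) has_fps_expansion binomial_fps a (c / of_real d)"
    if "d > 0" for d :: real and a c
  proof -
    have "(\<lambda>w. of_real d powr - a * (of_real d + c * w) powr a) has_fps_expansion
        fps_const (of_real d powr - a) * (fps_const (of_real d powr a) * binomial_fps a (c / of_real d))"
      using has_fps_expansion_powr_linear[OF that, of c a] unfolding B
      by (rule has_fps_expansion_cmult_left)
    also have "fps_const (of_real d powr - a) * (fps_const (of_real d powr a) * binomial_fps a (c / of_real d)) =
        fps_const (of_real d powr - a * of_real d powr a) * binomial_fps a (c / of_real d)"
      by (simp only: mult.assoc[symmetric] fps_const_mult)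
    also have "of_real d powr - a * of_real d powr a = (1 :: complex)"
      using that by (simp flip: powr_add)
    finally show ?thesis by simp
  qed
  have "jacobi_f \<alpha> \<beta> x = (\<lambda>w. (of_real p powr - (\<alpha> + 1/2) * (of_real p + (- 1) * w) powr (\<alpha> + 1/2)) *
      (of_real q powr - (\<beta> + 1/2) * (of_real q + 1 * w) powr (\<beta> + 1/2)))"
    by (simp add: fun_eq_iff jacobi_f_def p_def q_def algebra_simps)
  then show ?thesis
    using has_fps_expansion_mult[OF E[OF pq(1), of "\<alpha> + 1/2" "-1"] E[OF pq(2), of "\<beta> + 1/2" 1]]
    by (simp add: p_def q_def)
qed

text \<open>n + \<alpha> = (\<alpha> + 1/2) + (n - 1/2), and likewise for \<beta>, splits the
  binomial series into those of f, in a rescaled variable, and \<open>ultra_fps\<close>. The sum is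
  their Cauchy product.\<close>

lemma jacobi_poly_eq_sum_ultra:
  assumes x: "-1 < x" "x < 1"
  shows "jacobi_poly (int n) \<alpha> \<beta> x =
    (\<Sum>i\<le>n. (deriv ^^ i) (jacobi_f \<alpha> \<beta> x) 0 / fact i * ultra x n i)"
proof -
  define p q where "p = complex_of_real (1 - x)" and "q = complex_of_real (1 + x)"
  have "p \<noteq> 0" "q \<noteq> 0" using x by (auto simp only: p_def q_def of_real_eq_0_iff)
  \<comment> \<open>The scale s turns the slopes -1 / p and 1 / q of f into (x + 1) / 2 and (x - 1)
    / 2; in coefficient i it leaves the factor s^i.\<close>
  define s where "s = - (p * q) / 2"
  have s: "- complex_of_real (1 - x\<^sup>2) / 2 = s"
    by (simp add: s_def p_def q_def power2_eq_square algebra_simps)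
  have e: "(of_real x + 1) / 2 = s * (- 1 / p)" "(of_real x - 1) / 2 = s * (1 / q)"
    using \<open>p \<noteq> 0\<close> \<open>q \<noteq> 0\<close> by (simp_all add: s_def) (simp_all add: p_def q_def)
  have scale: "fps_nth (binomial_fps a (s * c) * binomial_fps b (s * d)) i =
      s ^ i * fps_nth (binomial_fps a c * binomial_fps b d) i" for a b c d i
    by (auto simp: fps_mult_nth sum_distrib_left power_mult_distrib mult_ac simp flip: power_add intro!: sum.cong)
  have f: "(deriv ^^ i) (jacobi_f \<alpha> \<beta> x) 0 / fact i =
      fps_nth (binomial_fps (\<alpha> + 1/2) (- 1 / p) * binomial_fps (\<beta> + 1/2) (1 / q)) i" for i
    using fps_nth_fps_expansion[OF jacobi_f_has_fps_expansion[OF x]] by (simp add: p_def q_def)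
  have split: "of_nat n + a = (a + 1/2) + (of_nat n - 1/2 :: complex)" for a by simp
  have "jacobi_poly (int n) \<alpha> \<beta> x =
      fps_nth (binomial_fps (\<alpha> + 1/2) (s * (- 1 / p)) * binomial_fps (\<beta> + 1/2) (s * (1 / q)) * ultra_fps x n) n"
    unfolding jacobi_poly_eq_fps_nth[OF x] split[of \<alpha>] split[of \<beta>] binomial_fps_add ultra_fps_def e
    by (simp only: mult_ac)
  also have "\<dots> = (\<Sum>i\<le>n. s ^ i * ((deriv ^^ i) (jacobi_f \<alpha> \<beta> x) 0 / fact i) * fps_nth (ultra_fps x n) (n - i))"
    unfolding fps_mult_nth[of _ "ultra_fps x n"] scale f atLeast0AtMost ..
  also have "\<dots> = (\<Sum>i\<le>n. (deriv ^^ i) (jacobi_f \<alpha> \<beta> x) 0 / fact i * ultra x n i)"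
    unfolding ultra_def s by (intro sum.cong) auto
  finally show ?thesis .
qed

section \<open>Powers of the quadratic factor\<close>

text \<open>\<open>quad_shift t c k\<close> is (E^2 + t)^k applied to the sequence c, where E is the
  shift. This is the transpose of multiplication by (X^2 + t)^k.\<close>

primrec quad_shift :: "complex \<Rightarrow> (nat \<Rightarrow> complex) \<Rightarrow> nat \<Rightarrow> nat \<Rightarrow> complex" where
  "quad_shift t c 0 m = c m"
| "quad_shift t c (Suc k) m = quad_shift t c k (m + 2) + t * quad_shift t c k m"

lemma quad_shift_eq_sum:
  "quad_shift t c k m = (\<Sum>j\<le>k. of_nat (k choose j) * t ^ (k - j) * c (m + 2 * j))"
proof (induction k arbitrary: m)
  case (Suc k)
  have "(\<Sum>j\<le>Suc k. of_nat (Suc k choose j) * t ^ (Suc k - j) * c (m + 2 * j)) =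
      t ^ Suc k * c m + (\<Sum>j\<le>k. of_nat (k choose j) * t ^ (k - j) * c (m + 2 + 2 * j)) +
      (\<Sum>j\<le>k. of_nat (k choose Suc j) * t ^ (k - j) * c (m + 2 * Suc j))"
    by (simp add: sum.atMost_Suc_shift sum.distrib algebra_simps del: sum.atMost_Suc)
  \<comment> \<open>At j = k the coefficient k choose Suc k is 0. For smaller j a factor t can then
    be split off, since k - j = Suc (k - Suc j).\<close>
  also have "(\<Sum>j\<le>k. of_nat (k choose Suc j) * t ^ (k - j) * c (m + 2 * Suc j)) =
      (\<Sum>j<k. of_nat (k choose Suc j) * t ^ (k - j) * c (m + 2 * Suc j))"
    by (intro sum.mono_neutral_right) auto
  also have "\<dots> = t * (\<Sum>j<k. of_nat (k choose Suc j) * t ^ (k - Suc j) * c (m + 2 * Suc j))"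
    unfolding sum_distrib_left
    by (intro sum.cong refl) (auto simp: mult_ac simp flip: power_Suc Suc_diff_Suc)
  also have "t ^ Suc k * c m + (\<Sum>j\<le>k. of_nat (k choose j) * t ^ (k - j) * c (m + 2 + 2 * j)) +
       t * (\<Sum>j<k. of_nat (k choose Suc j) * t ^ (k - Suc j) * c (m + 2 * Suc j)) =
      (\<Sum>j\<le>k. of_nat (k choose j) * t ^ (k - j) * c (m + 2 + 2 * j)) +
      t * (\<Sum>j\<le>k. of_nat (k choose j) * t ^ (k - j) * c (m + 2 * j))"
    by (simp add: lessThan_Suc_atMost[symmetric] sum.lessThan_Suc_shift algebra_simps del: sum.lessThan_Suc)
  finally show ?case by (simp add: Suc.IH)
qed simp

section \<open>Pairing a formal power series with a sequence\<close>

definition fps_pairing :: "nat \<Rightarrow> (nat \<Rightarrow> complex) \<Rightarrow> complex fps \<Rightarrow> complex" where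
  "fps_pairing n c F = (\<Sum>i\<le>n. fps_nth F i * c i)"

lemma fps_pairing_add: "fps_pairing n c (F + G) = fps_pairing n c F + fps_pairing n c G"
  by (simp add: fps_pairing_def ring_distribs sum.distrib)

lemma fps_pairing_const_mult: "fps_pairing n c (fps_const a * F) = a * fps_pairing n c F"
  by (simp add: fps_pairing_def sum_distrib_left mult.assoc)

lemma fps_pairing_sum: "fps_pairing n c (\<Sum>k\<in>K. F k) = (\<Sum>k\<in>K. fps_pairing n c (F k))"
  by (simp add: fps_pairing_def fps_sum_nth sum_distrib_right sum.swap[of _ _ K])

text \<open>Multiplication by X is the transpose of the shift. Truncation at n costs nothing: the
  extra term on the right contains c (Suc n) = 0.\<close>

lemma fps_pairing_X_mult:
  assumes "\<And>i. i > n \<Longrightarrow> c i = 0"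
  shows "fps_pairing n c (fps_X * F) = fps_pairing n (\<lambda>i. c (Suc i)) F"
proof -
  have "fps_pairing n c (fps_X * F) = (\<Sum>i<Suc n. fps_nth (fps_X * F) i * c i)"
    by (simp add: fps_pairing_def lessThan_Suc_atMost)
  also have "\<dots> = (\<Sum>i<n. fps_nth F i * c (Suc i))"
    by (subst sum.lessThan_Suc_shift) simp
  also have "\<dots> = (\<Sum>i\<le>n. fps_nth F i * c (Suc i))"
    using assms by (intro sum.mono_neutral_left) auto
  finally show ?thesis by (simp add: fps_pairing_def)
qed

text \<open>m stays arbitrary because X^2 moves it by 2 in the induction. At k = 0 the pairing with
  1 picks out c m.\<close>

lemma fps_pairing_quad_power:
  assumes "\<And>i. i > n \<Longrightarrow> c i = 0"
  shows "fps_pairing n (\<lambda>i. c (i + m)) ((fps_X ^ 2 + fps_const t) ^ k) = quad_shift t c k m"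
proof (induction k arbitrary: m)
  case 0
  then show ?case by (simp add: fps_pairing_def if_distrib[of "\<lambda>z. z * _"] cong: if_cong)
next
  case (Suc k)
  have *: "(fps_X ^ 2 + fps_const t) ^ Suc k =
      fps_X * (fps_X * (fps_X ^ 2 + fps_const t) ^ k) + fps_const t * (fps_X ^ 2 + fps_const t) ^ k"
    by (simp add: power2_eq_square algebra_simps)
  show ?case
    unfolding * fps_pairing_add fps_pairing_const_mult
    using Suc.IH[of m] Suc.IH[of "m + 2"] assms by (simp add: fps_pairing_X_mult)
qed

section \<open>Recurrence for the shifted weights and their decay in n\<close>

text \<open>Multiplying by the index does not commute with \<open>quad_shift\<close>; the commutator is the
  last group of terms.\<close>

lemma quad_shift_Suc_rec:
  fixes N X :: complex
  assumes rec: "\<And>m. (N + of_nat (Suc m)) * c (m + 2) + X * of_nat (2 * m + 1) * c (Suc m) + t * (N - of_nat m) * c m = 0"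
  shows "N * quad_shift t c (Suc k) m =
    - of_nat m * (quad_shift t c k (m + 2) - t * quad_shift t c k m) - quad_shift t c k (m + 2)
    - of_nat (2 * m + 1) * X * quad_shift t c k (Suc m)
    - 2 * of_nat k * (quad_shift t c (k - 1) (m + 4) - t * quad_shift t c (k - 1) (m + 2)
        + 2 * X * quad_shift t c (k - 1) (m + 3))"
proof (induction k arbitrary: m)
  case 0
  show ?case using rec[of m] by simp algebra
next
  case (Suc k)
  have 1: "N * quad_shift t c (Suc (Suc k)) m = N * quad_shift t c (Suc k) (m + 2) + t * (N * quad_shift t c (Suc k) m)"
    by (simp only: quad_shift.simps ring_distribs mult.left_commute)
  show ?case
  \<comment> \<open>At k = 0 the truncated \<open>k - 1\<close> is multiplied by 0. For k = Suc l
    all terms unfold to order l, where both sides can be compared.\<close>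
  proof (cases k)
    case 0
    show ?thesis unfolding 1 Suc.IH unfolding 0
      by (simp add: numeral_eq_Suc algebra_simps)
  next
    case (Suc l)
    show ?thesis unfolding 1 Suc.IH unfolding Suc
      by (simp add: numeral_eq_Suc algebra_simps)
  qed
qed

text \<open>Let e = (k + 1) div 2 and multiply \<open>quad_shift_Suc_rec\<close> by n^(e - 1). The
  right side is bounded by induction: order k - 2 admits exactly the exponent e - 1, order k - 1 at
  least that. All m are treated together, since the recurrence moves m.\<close>

lemma norm_quad_shift_le_power:
  fixes c :: "nat \<Rightarrow> nat \<Rightarrow> complex"
  assumes rec: "\<And>n m. (of_nat n + of_nat (Suc m)) * c n (m + 2) + X * of_nat (2 * m + 1) * c n (Suc m) + t * (of_nat n - of_nat m) * c n m = 0"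
    and bounded: "\<And>m. \<exists>C. \<forall>n. norm (c n m) \<le> C"
  shows "\<exists>C. \<forall>n. real n ^ ((k + 1) div 2) * norm (quad_shift t (c n) k m) \<le> C"
proof (induction k arbitrary: m rule: less_induct)
  case (less k)
  show ?case
  proof (cases k)
    case 0
    then show ?thesis using bounded by simp
  next
    case (Suc l)
    define d where "d = (l + 1) div 2"
    define e where "e = (k + 1) div 2"
    have bl: "\<exists>C. \<forall>n. real n ^ (e - 1) * norm (quad_shift t (c n) l j) \<le> C" for j
    proof -
      obtain C where C: "\<And>n. real n ^ d * norm (quad_shift t (c n) l j) \<le> C"
        using less.IH[of l j] Suc d_def by auto
      \<comment> \<open>At n = 0 the power with exponent e - 1 may be 0^0 = 1 although 0^d = 0, so
        the value at n = 0 enters the bound separately.\<close>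
      have "real n ^ (e - 1) * norm (quad_shift t (c n) l j) \<le> max C (norm (quad_shift t (c 0) l j))" for n
      proof (cases "n = 0")
        case False
        have "real n ^ (e - 1) \<le> real n ^ d"
          using False Suc by (intro power_increasing) (auto simp: e_def d_def)
        then have "real n ^ (e - 1) * norm (quad_shift t (c n) l j) \<le> real n ^ d * norm (quad_shift t (c n) l j)"
          by (rule mult_right_mono) simp
        with C[of n] show ?thesis by linarith
      qed (auto simp: power_0_left le_max_iff_disj)
      then show ?thesis by blast
    qed
    \<comment> \<open>The factor l stays attached, so that the truncated index l - 1 does no harm at
      l = 0.\<close>
    have bl': "\<exists>C. \<forall>n. real n ^ (e - 1) * norm (of_nat l * quad_shift t (c n) (l - 1) j) \<le> C" for j
    proof (cases l)
      case (Suc i)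
      then have "e - 1 = (i + 1) div 2" using \<open>k = Suc l\<close> by (simp add: e_def)
      then obtain C where C: "\<And>n. real n ^ (e - 1) * norm (quad_shift t (c n) i j) \<le> C"
        using less.IH[of i j] Suc \<open>k = Suc l\<close> by auto
      have "real n ^ (e - 1) * norm (of_nat l * quad_shift t (c n) (l - 1) j) \<le> real l * C" for n
        using mult_left_mono[OF C[of n], of "real l"] Suc by (simp add: norm_mult mult_ac del: of_nat_Suc)
      then show ?thesis by blast
    qed (auto intro: exI[of _ 0])
    obtain C1 C2 C3 D1 D2 D3 where C:
      "\<And>n. real n ^ (e - 1) * norm (quad_shift t (c n) l (m + 2)) \<le> C1"
      "\<And>n. real n ^ (e - 1) * norm (quad_shift t (c n) l m) \<le> C2"
      "\<And>n. real n ^ (e - 1) * norm (quad_shift t (c n) l (Suc m)) \<le> C3"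
      "\<And>n. real n ^ (e - 1) * norm (of_nat l * quad_shift t (c n) (l - 1) (m + 4)) \<le> D1"
      "\<And>n. real n ^ (e - 1) * norm (of_nat l * quad_shift t (c n) (l - 1) (m + 2)) \<le> D2"
      "\<And>n. real n ^ (e - 1) * norm (of_nat l * quad_shift t (c n) (l - 1) (m + 3)) \<le> D3"
      using bl[of "m + 2"] bl[of m] bl[of "Suc m"] bl'[of "m + 4"] bl'[of "m + 2"] bl'[of "m + 3"] by blast
    show ?thesis
    proof (intro exI allI)
      fix n
      let ?q = "quad_shift t (c n)"
      have e: "real n ^ e = real n ^ (e - 1) * real n" using Suc by (simp add: e_def flip: power_Suc2)
      have "of_nat n * ?q k m =
          - of_nat (m + 1) * ?q l (m + 2) + (of_nat m * t) * ?q l m - (of_nat (2 * m + 1) * X) * ?q l (Suc m)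
          - 2 * (of_nat l * ?q (l - 1) (m + 4)) + (2 * t) * (of_nat l * ?q (l - 1) (m + 2))
          - (4 * X) * (of_nat l * ?q (l - 1) (m + 3))"
        unfolding Suc quad_shift_Suc_rec[of "of_nat n" "c n", OF rec] by (simp add: algebra_simps)
      then have "norm (of_nat n * ?q k m) \<le>
          norm (- of_nat (m + 1) * ?q l (m + 2)) + norm ((of_nat m * t) * ?q l m) + norm ((of_nat (2 * m + 1) * X) * ?q l (Suc m))
          + norm (2 * (of_nat l * ?q (l - 1) (m + 4))) + norm ((2 * t) * (of_nat l * ?q (l - 1) (m + 2)))
          + norm ((4 * X) * (of_nat l * ?q (l - 1) (m + 3)))"
        by (simp only:) (intro norm_triangle_le norm_triangle_le_diff add_mono order_refl)
      then have "real n * norm (?q k m) \<le>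
          real (m + 1) * norm (?q l (m + 2)) + norm (of_nat m * t) * norm (?q l m)
          + norm (of_nat (2 * m + 1) * X) * norm (?q l (Suc m))
          + 2 * norm (of_nat l * ?q (l - 1) (m + 4)) + norm (2 * t) * norm (of_nat l * ?q (l - 1) (m + 2))
          + norm (4 * X) * norm (of_nat l * ?q (l - 1) (m + 3))"
        unfolding norm_mult norm_minus_cancel norm_of_nat norm_numeral .
      from mult_left_mono[OF this, of "real n ^ (e - 1)"]
      have "real n ^ e * norm (?q k m) \<le>
          real (m + 1) * (real n ^ (e - 1) * norm (?q l (m + 2)))
          + norm (of_nat m * t) * (real n ^ (e - 1) * norm (?q l m))
          + norm (of_nat (2 * m + 1) * X) * (real n ^ (e - 1) * norm (?q l (Suc m)))
          + 2 * (real n ^ (e - 1) * norm (of_nat l * ?q (l - 1) (m + 4)))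
          + norm (2 * t) * (real n ^ (e - 1) * norm (of_nat l * ?q (l - 1) (m + 2)))
          + norm (4 * X) * (real n ^ (e - 1) * norm (of_nat l * ?q (l - 1) (m + 3)))"
        unfolding e by (simp only: ring_distribs mult_ac zero_le_power of_nat_0_le_iff simp_thms)
      also have "\<dots> \<le> real (m + 1) * C1 + norm (of_nat m * t) * C2 + norm (of_nat (2 * m + 1) * X) * C3
          + 2 * D1 + norm (2 * t) * D2 + norm (4 * X) * D3"
        by (intro add_mono mult_left_mono C) auto
      finally show "real n ^ ((k + 1) div 2) * norm (?q k m) \<le> real (m + 1) * C1 + norm (of_nat m * t) * C2
          + norm (of_nat (2 * m + 1) * X) * C3 + 2 * D1 + norm (2 * t) * D2 + norm (4 * X) * D3"
        by (simp only: e_def)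
    qed
  qed
qed

section \<open>Convergence of two-point Taylor expansions\<close>

text \<open>E is g composed with a square root. The principal branch gives holomorphy off the
  nonpositive reals, the branch \<open>\<i> * csqrt (- u)\<close> off the nonnegative ones; both
  agree because g is even. At 0 continuity removes the singularity.\<close>

lemma even_holomorphic_factor:
  assumes g: "g holomorphic_on {w. w\<^sup>2 \<in> U}" and U: "open U"
    and even: "\<And>w. w\<^sup>2 \<in> U \<Longrightarrow> g (- w) = g w"
  obtains E where "E holomorphic_on U" "\<And>w. w\<^sup>2 \<in> U \<Longrightarrow> g w = E (w\<^sup>2)"
proof -
  define E where "E = (\<lambda>u. g (csqrt u))"
  have eq: "g w = E (w\<^sup>2)" if "w\<^sup>2 \<in> U" for w
  proof -
    have "csqrt (w\<^sup>2) = w \<or> csqrt (w\<^sup>2) = - w" by (simp flip: power2_eq_iff)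
    then show ?thesis using even[OF that] by (auto simp: E_def)
  qed
  have op: "open {w::complex. w\<^sup>2 \<in> U}"
    using open_vimage[OF U, of "\<lambda>w. w\<^sup>2"] by (simp add: vimage_def continuous_intros)
  have away: "E holomorphic_on U - \<real>\<^sub>\<le>\<^sub>0"
    unfolding E_def
    by (rule holomorphic_on_compose_gen[OF _ g, unfolded o_def])
       (auto intro!: holomorphic_intros)
  have "(\<lambda>u. g (\<i> * csqrt (- u))) holomorphic_on U - \<real>\<^sub>\<ge>\<^sub>0"
    by (rule holomorphic_on_compose_gen[OF _ g, unfolded o_def])
       (auto intro!: holomorphic_intros simp: power_mult_distrib complex_nonpos_Reals_iff complex_nonneg_Reals_iff)
  moreover have "g (\<i> * csqrt (- u)) = E u" if "u \<in> U" for u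
    using eq[of "\<i> * csqrt (- u)"] that by (simp add: power_mult_distrib)
  ultimately have "E holomorphic_on U - \<real>\<^sub>\<ge>\<^sub>0"
    by (rule holomorphic_transform) auto
  moreover have "closed (\<real>\<^sub>\<ge>\<^sub>0 :: complex set)" "closed (\<real>\<^sub>\<le>\<^sub>0 :: complex set)" by auto
  ultimately have "E holomorphic_on (U - \<real>\<^sub>\<le>\<^sub>0) \<union> (U - \<real>\<^sub>\<ge>\<^sub>0)"
    using away U by (intro holomorphic_on_Un) auto
  moreover have "U - {0} \<subseteq> (U - \<real>\<^sub>\<le>\<^sub>0) \<union> (U - \<real>\<^sub>\<ge>\<^sub>0)"
    by (auto simp: complex_nonpos_Reals_iff complex_nonneg_Reals_iff complex_eq_iff)
  ultimately have hol0: "E holomorphic_on U - {0}"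
    by (rule holomorphic_on_subset)
  have "E holomorphic_on U"
  proof (cases "0 \<in> U")
    case False
    then show ?thesis using hol0 by simp
  next
    case True
    show ?thesis
    proof (rule no_isolated_singularity'[OF _ hol0 U])
    fix z :: complex assume "z \<in> {0}"
    then have z: "z = 0" by simp
    then have "0 \<in> U" using True by simp
    have "isCont g 0"
      using holomorphic_on_imp_continuous_on[OF g] op \<open>0 \<in> U\<close> by (simp add: continuous_on_eq_continuous_at)
    moreover have "(csqrt \<longlongrightarrow> 0) (at 0)"
    proof (rule tendsto_norm_zero_cancel)
      have "((\<lambda>u::complex. sqrt (norm u)) \<longlongrightarrow> sqrt (norm (0::complex))) (at 0)"
        by (intro tendsto_intros)
      then show "((\<lambda>u. norm (csqrt u)) \<longlongrightarrow> 0) (at 0)" by (simp add: norm_csqrt)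
    qed
    ultimately have "((\<lambda>u. g (csqrt u)) \<longlongrightarrow> g 0) (at 0)"
      by (rule isCont_tendsto_compose)
    then show "(E \<longlongrightarrow> E z) (at z within U)"
      unfolding z E_def by (auto intro: tendsto_within_subset)
  qed auto
  qed
  then show ?thesis using eq by (rule that)
qed

text \<open>Splitting a function into its even part and \<open>w\<close> times an even function turns the two-point
  expansion into two ordinary Taylor expansions in the variable \<open>w\<^sup>2\<close>.\<close>

lemma holomorphic_even_odd_split:
  assumes f: "f holomorphic_on {w. w\<^sup>2 \<in> U}" and U: "open U"
  obtains E H where "E holomorphic_on U" "H holomorphic_on U"
    "\<And>w. w\<^sup>2 \<in> U \<Longrightarrow> f w = E (w\<^sup>2) + w * H (w\<^sup>2)"
proof -
  let ?D = "{w. w\<^sup>2 \<in> U}"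
  have op: "open ?D"
    using open_vimage[OF U, of "\<lambda>w. w\<^sup>2"] by (simp add: vimage_def continuous_intros)
  have fm: "(\<lambda>w. f (- w)) holomorphic_on ?D"
    by (rule holomorphic_on_compose_gen[OF _ f, unfolded o_def]) (auto intro!: holomorphic_intros)
  define fe fo where "fe = (\<lambda>w. (f w + f (- w)) / 2)" and "fo = (\<lambda>w. (f w - f (- w)) / 2)"
  have "fe holomorphic_on ?D" and fo: "fo holomorphic_on ?D"
    unfolding fe_def fo_def by (intro holomorphic_intros f fm; simp)+
  moreover have "fe (- w) = fe w" for w by (simp add: fe_def add.commute)
  ultimately obtain E where E: "E holomorphic_on U" "\<And>w. w\<^sup>2 \<in> U \<Longrightarrow> fe w = E (w\<^sup>2)"
    using even_holomorphic_factor[OF _ U, of fe] by blast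
  \<comment> \<open>The odd part vanishes at 0, so its quotient by w extends holomorphically, and
    this quotient is even.\<close>
  define h where "h = (\<lambda>w. if w = 0 then deriv fo 0 else fo w / w)"
  have "h holomorphic_on ?D"
    by (rule pole_theorem_open_0[OF fo op, where a = 0]) (auto simp: h_def fo_def)
  moreover have "h (- w) = h w" for w by (simp add: h_def fo_def field_simps)
  ultimately obtain H where H: "H holomorphic_on U" "\<And>w. w\<^sup>2 \<in> U \<Longrightarrow> h w = H (w\<^sup>2)"
    using even_holomorphic_factor[OF _ U, of h] by blast
  have "f w = fe w + w * h w" for w
    by (cases "w = 0") (simp_all add: fe_def h_def fo_def field_simps)
  then show ?thesis using that[OF E(1) H(1)] E(2) H(2) by simp
qed

section \<open>Tails and uniform convergence of power series\<close>

lemma power_series_tail_holomorphic: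
  fixes a :: "nat \<Rightarrow> complex"
  assumes r: "r > 0" and sums: "\<And>u. u \<in> ball 0 r \<Longrightarrow> (\<lambda>k. a k * u ^ k) sums F u"
  obtains G where "G holomorphic_on ball 0 r"
    "\<And>u. u \<in> ball 0 r \<Longrightarrow> F u = (\<Sum>k<N. a k * u ^ k) + u ^ N * G u"
proof -
  define G where "G = (\<lambda>u. \<Sum>k. a (k + N) * u ^ k)"
  have G: "(\<lambda>k. a (k + N) * u ^ k) sums G u" and eq: "F u = (\<Sum>k<N. a k * u ^ k) + u ^ N * G u"
    if u: "u \<in> ball 0 r" for u
  proof -
    have t: "(\<lambda>k. a (k + N) * u ^ (k + N)) sums (F u - (\<Sum>k<N. a k * u ^ k))"
      using sums_split_initial_segment[OF sums[OF u], of N] by simp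
    show "(\<lambda>k. a (k + N) * u ^ k) sums G u"
    proof (cases "u = 0")
      case True
      then have "summable (\<lambda>k. a (k + N) * u ^ k)"
        by (intro summable_finite[of "{0}"]) auto
      then show ?thesis unfolding G_def by (rule summable_sums)
    next
      case False
      then have "(\<lambda>k. a (k + N) * u ^ k) sums ((F u - (\<Sum>k<N. a k * u ^ k)) / u ^ N)"
        using sums_divide[OF t, of "u ^ N"] by (simp add: power_add)
      then show ?thesis unfolding G_def using sums_summable summable_sums by blast
    qed
    then have "(\<lambda>k. a (k + N) * u ^ (k + N)) sums (G u * u ^ N)"
      using sums_mult2[of "\<lambda>k. a (k + N) * u ^ k" "G u" "u ^ N"] by (simp add: power_add mult.assoc)
    with t have "F u - (\<Sum>k<N. a k * u ^ k) = G u * u ^ N" by (rule sums_unique2)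
    then show "F u = (\<Sum>k<N. a k * u ^ k) + u ^ N * G u" by (simp add: algebra_simps)
  qed
  have "G holomorphic_on ball 0 r"
    by (rule power_series_holomorphic[of 0 r "\<lambda>k. a (k + N)"]) (use G in auto)
  then show ?thesis using eq by (rule that)
qed

lemma power_series_uniform_limit:
  fixes a :: "nat \<Rightarrow> complex"
  assumes sums: "\<And>u. u \<in> ball 0 r \<Longrightarrow> (\<lambda>k. a k * u ^ k) sums F u" and "0 < s" "s < r"
  shows "uniform_limit (cball 0 s) (\<lambda>N u. \<Sum>k<N. a k * u ^ k) F sequentially"
proof -
  \<comment> \<open>A radius strictly between s and r: convergence at the point t makes the radius
    of convergence at least t > s.\<close>
  define t where "t = (s + r) / 2"
  have t: "s < t" "t < r" "0 < t" using assms by (auto simp: t_def)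
  have "summable (\<lambda>k. a k * of_real t ^ k)"
    using sums[of "of_real t"] t sums_summable by force
  then have "ereal s < conv_radius a"
    using conv_radius_geI[of a "of_real t"] t by (auto intro: less_le_trans[of _ "ereal t"])
  then have "uniform_limit (cball 0 s) (\<lambda>N u. \<Sum>k<N. a k * (u - 0) ^ k) (\<lambda>u. suminf (\<lambda>k. a k * (u - 0) ^ k)) sequentially"
    by (rule powser_uniform_limit)
  then show ?thesis
    by (rule uniform_limit_cong'[THEN iffD1, rotated 2])
       (use sums \<open>s < r\<close> in \<open>auto simp: sums_iff\<close>)
qed

text \<open>The set \<open>{w. cmod (w\<^sup>2 - c\<^sup>2) < r}\<close> is bounded by a Cassini oval with foci \<open>c\<close> and \<open>-c\<close>.\<close>

lemma two_point_taylor_uniform_limit: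
  assumes f: "f holomorphic_on {w. cmod (w\<^sup>2 - c\<^sup>2) < r}" and c: "c \<noteq> 0"
    and AB: "is_two_point_taylor f c A B" and s: "0 < s" "s < r"
  shows "uniform_limit {w. cmod (w\<^sup>2 - c\<^sup>2) \<le> s}
           (\<lambda>N w. \<Sum>k<N. (A k + B k * w) * (w\<^sup>2 - c\<^sup>2) ^ k) f sequentially"
proof -
  have r: "0 < r" using s by simp
  have D: "{w. cmod (w\<^sup>2 - c\<^sup>2) < r} = {w. w\<^sup>2 \<in> ball (c\<^sup>2) r}" by (auto simp: dist_norm norm_minus_commute)
  obtain E H where EH: "E holomorphic_on ball (c\<^sup>2) r" "H holomorphic_on ball (c\<^sup>2) r"
    and fEH: "\<And>w. w\<^sup>2 \<in> ball (c\<^sup>2) r \<Longrightarrow> f w = E (w\<^sup>2) + w * H (w\<^sup>2)"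
    using holomorphic_even_odd_split[OF f[unfolded D] open_ball] by blast
  \<comment> \<open>By uniqueness these Taylor coefficients at c^2 are A and B once they satisfy the
    defining property.\<close>
  define a b where "a = (\<lambda>k. (deriv ^^ k) E (c\<^sup>2) / fact k)" and "b = (\<lambda>k. (deriv ^^ k) H (c\<^sup>2) / fact k)"
  have in_ball: "c\<^sup>2 + u \<in> ball (c\<^sup>2) r" if "u \<in> ball 0 r" for u
    using that by (simp add: dist_norm)
  have sa: "(\<lambda>k. a k * u ^ k) sums E (c\<^sup>2 + u)" and sb: "(\<lambda>k. b k * u ^ k) sums H (c\<^sup>2 + u)"
    if "u \<in> ball 0 r" for u
    using holomorphic_power_series[OF EH(1) in_ball[OF that]] holomorphic_power_series[OF EH(2) in_ball[OF that]]
    by (simp_all add: a_def b_def)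
  have fw: "f w = E (c\<^sup>2 + (w\<^sup>2 - c\<^sup>2)) + w * H (c\<^sup>2 + (w\<^sup>2 - c\<^sup>2))" if "cmod (w\<^sup>2 - c\<^sup>2) < r" for w
    using fEH[of w] that by (simp add: dist_norm norm_minus_commute)
  have "is_two_point_taylor f c a b"
    unfolding is_two_point_taylor_def
  proof
    fix N
    obtain P where P: "P holomorphic_on ball 0 r"
      "\<And>u. u \<in> ball 0 r \<Longrightarrow> E (c\<^sup>2 + u) = (\<Sum>k<N. a k * u ^ k) + u ^ N * P u"
      using power_series_tail_holomorphic[OF r sa] by blast
    obtain Q where Q: "Q holomorphic_on ball 0 r"
      "\<And>u. u \<in> ball 0 r \<Longrightarrow> H (c\<^sup>2 + u) = (\<Sum>k<N. b k * u ^ k) + u ^ N * Q u"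
      using power_series_tail_holomorphic[OF r sb] by blast
    let ?g = "\<lambda>w. P (w\<^sup>2 - c\<^sup>2) + w * Q (w\<^sup>2 - c\<^sup>2)"
    let ?D = "{w. cmod (w\<^sup>2 - c\<^sup>2) < r}"
    have op: "open ?D" by (intro open_Collect_less continuous_intros)
    have "(\<lambda>w. P (w\<^sup>2 - c\<^sup>2)) holomorphic_on ?D" "(\<lambda>w. Q (w\<^sup>2 - c\<^sup>2)) holomorphic_on ?D"
      by (rule holomorphic_on_compose_gen[OF _ P(1), unfolded o_def]
               holomorphic_on_compose_gen[OF _ Q(1), unfolded o_def];
          auto intro!: holomorphic_intros)+
    then have "?g holomorphic_on ?D" by (intro holomorphic_intros)
    then have "?g analytic_on ?D" using op by (simp add: analytic_on_open)
    then have "?g analytic_on {c, -c}" by (rule analytic_on_subset) (use r in auto)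
    moreover have "\<forall>\<^sub>F w in at z.
        (f w - (\<Sum>k<N. (a k + b k * w) * (w\<^sup>2 - c\<^sup>2) ^ k)) / (w\<^sup>2 - c\<^sup>2) ^ N = ?g w" if z: "z \<in> {c, -c}" for z
    proof -
      have "\<forall>\<^sub>F w in at z. w \<in> ?D"
        using z r op by (intro eventually_at_in_open') auto
      moreover have "\<forall>\<^sub>F w in at z. w \<noteq> c" "\<forall>\<^sub>F w in at z. w \<noteq> -c"
        by (auto intro: eventually_neq_at_within)
      ultimately show ?thesis
      proof eventually_elim
        case (elim w)
        define u where "u = w\<^sup>2 - c\<^sup>2"
        have u: "u \<noteq> 0" using elim(2,3) by (auto simp: power2_eq_iff u_def)
        have ub: "u \<in> ball 0 r" using elim by (simp add: u_def)
        have "(\<Sum>k<N. (a k + b k * w) * u ^ k) = (\<Sum>k<N. a k * u ^ k) + w * (\<Sum>k<N. b k * u ^ k)"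
          by (simp add: sum_distrib_left sum.distrib algebra_simps)
        moreover have "f w = E (c\<^sup>2 + u) + w * H (c\<^sup>2 + u)" using fw[of w] elim by (simp add: u_def)
        ultimately have "f w - (\<Sum>k<N. (a k + b k * w) * u ^ k) = u ^ N * (P u + w * Q u)"
          using P(2)[OF ub] Q(2)[OF ub] by (simp add: algebra_simps)
        then show ?case using u by (simp flip: u_def)
      qed
    qed
    ultimately show "\<exists>g. g analytic_on {c, -c} \<and> (\<forall>z\<in>{c, -c}. \<forall>\<^sub>F w in at z.
        (f w - (\<Sum>k<N. (a k + b k * w) * (w\<^sup>2 - c\<^sup>2) ^ k)) / (w\<^sup>2 - c\<^sup>2) ^ N = g w)"
      by (intro exI[of _ ?g]) auto
  qed
  then have ab: "A = a" "B = b"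
    using is_two_point_taylor_unique[OF AB _ c] by auto
  let ?S = "{w. cmod (w\<^sup>2 - c\<^sup>2) \<le> s}"
  have u1: "uniform_limit (cball 0 s) (\<lambda>N u. \<Sum>k<N. a k * u ^ k) (\<lambda>u. E (c\<^sup>2 + u)) sequentially"
    and u2: "uniform_limit (cball 0 s) (\<lambda>N u. \<Sum>k<N. b k * u ^ k) (\<lambda>u. H (c\<^sup>2 + u)) sequentially"
    using power_series_uniform_limit[OF sa s] power_series_uniform_limit[OF sb s] by simp_all
  have u1': "uniform_limit ?S (\<lambda>N w. \<Sum>k<N. a k * (w\<^sup>2 - c\<^sup>2) ^ k) (\<lambda>w. E (c\<^sup>2 + (w\<^sup>2 - c\<^sup>2))) sequentially"
    using uniform_limit_compose'[OF u1, where B = ?S and h = "\<lambda>w. w\<^sup>2 - c\<^sup>2"] by auto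
  have u2': "uniform_limit ?S (\<lambda>N w. \<Sum>k<N. b k * (w\<^sup>2 - c\<^sup>2) ^ k) (\<lambda>w. H (c\<^sup>2 + (w\<^sup>2 - c\<^sup>2))) sequentially"
    using uniform_limit_compose'[OF u2, where B = ?S and h = "\<lambda>w. w\<^sup>2 - c\<^sup>2"] by auto
  \<comment> \<open>On the oval |w|^2 \<le> s + |c^2| \<le> K^2, so multiplication by w preserves
    the uniform limit; the summand 1 ensures K \<le> K^2.\<close>
  define K where "K = s + cmod (c\<^sup>2) + 1"
  have K: "K > 0" using s by (simp add: K_def add_pos_nonneg)
  have bd: "cmod w \<le> K" if "w \<in> ?S" for w
  proof -
    have "(cmod w)\<^sup>2 \<le> s + cmod (c\<^sup>2)"
      using norm_triangle_sub[of "w\<^sup>2" "c\<^sup>2"] that by (simp add: norm_power)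
    also have "\<dots> \<le> K\<^sup>2" using s by (simp add: K_def power2_eq_square algebra_simps)
    finally show ?thesis by (rule power2_le_imp_le) (use K in simp)
  qed
  have "uniform_limit ?S (\<lambda>N w. w * (\<Sum>k<N. b k * (w\<^sup>2 - c\<^sup>2) ^ k)) (\<lambda>w. w * H (c\<^sup>2 + (w\<^sup>2 - c\<^sup>2))) sequentially"
    unfolding uniform_limit_iff
  proof (intro allI impI)
    fix e :: real assume "e > 0"
    then have "e / K > 0" using K by simp
    with u2' have "\<forall>\<^sub>F N in sequentially. \<forall>w\<in>?S.
        dist (\<Sum>k<N. b k * (w\<^sup>2 - c\<^sup>2) ^ k) (H (c\<^sup>2 + (w\<^sup>2 - c\<^sup>2))) < e / K"
      unfolding uniform_limit_iff by blast
    then show "\<forall>\<^sub>F N in sequentially. \<forall>w\<in>?S.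
        dist (w * (\<Sum>k<N. b k * (w\<^sup>2 - c\<^sup>2) ^ k)) (w * H (c\<^sup>2 + (w\<^sup>2 - c\<^sup>2))) < e"
    proof (eventually_elim, intro ballI)
      fix N w
      assume *: "\<forall>w\<in>?S. dist (\<Sum>k<N. b k * (w\<^sup>2 - c\<^sup>2) ^ k) (H (c\<^sup>2 + (w\<^sup>2 - c\<^sup>2))) < e / K" and w: "w \<in> ?S"
      have "dist (w * (\<Sum>k<N. b k * (w\<^sup>2 - c\<^sup>2) ^ k)) (w * H (c\<^sup>2 + (w\<^sup>2 - c\<^sup>2))) =
          cmod w * dist (\<Sum>k<N. b k * (w\<^sup>2 - c\<^sup>2) ^ k) (H (c\<^sup>2 + (w\<^sup>2 - c\<^sup>2)))"
        by (simp add: dist_norm flip: right_diff_distrib norm_mult)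
      also have "\<dots> \<le> K * dist (\<Sum>k<N. b k * (w\<^sup>2 - c\<^sup>2) ^ k) (H (c\<^sup>2 + (w\<^sup>2 - c\<^sup>2)))"
        by (intro mult_right_mono bd w) auto
      also have "\<dots> < K * (e / K)" using * w K by (intro mult_strict_left_mono) auto
      finally show "dist (w * (\<Sum>k<N. b k * (w\<^sup>2 - c\<^sup>2) ^ k)) (w * H (c\<^sup>2 + (w\<^sup>2 - c\<^sup>2))) < e"
        using K by simp
    qed
  qed
  from uniform_limit_add[OF u1' this]
  have "uniform_limit ?S (\<lambda>N w. \<Sum>k<N. (A k + B k * w) * (w\<^sup>2 - c\<^sup>2) ^ k)
      (\<lambda>w. E (c\<^sup>2 + (w\<^sup>2 - c\<^sup>2)) + w * H (c\<^sup>2 + (w\<^sup>2 - c\<^sup>2))) sequentially"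
    by (simp add: ab sum_distrib_left algebra_simps flip: sum.distrib)
  then show ?thesis
    by (rule uniform_limit_cong'[THEN iffD1, rotated 2]) (use s fw in auto)
qed

section \<open>The expansion of Jacobi polynomials\<close>

lemma power_diff_mult_half_power:
  fixes t :: complex
  assumes "j \<le> k"
  shows "t ^ (k - j) * (- t / 2) ^ (2 * j) = t ^ (k + j) / 4 ^ j"
proof -
  have "(- t / 2) ^ (2 * j) = t ^ (2 * j) / 4 ^ j"
    by (simp add: power_mult power_divide)
  moreover have "t ^ (k - j) * t ^ (2 * j) = t ^ (k + j)"
    using assms by (simp add: add.commute flip: power_add)
  ultimately show ?thesis by simp
qed

text \<open>With t = 1 - x^2, summand j takes t^(k - j) from \<open>quad_shift\<close> and (-t /
  2)^(2 j) from the weight of index 2 j, which explains t^(k + j) / 4^j.\<close>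

lemma Phi_eq_quad_shift:
  assumes "-1 < x" "x < 1"
  shows "Phi k x n = quad_shift (of_real (1 - x\<^sup>2)) (ultra x n) k 0"
  unfolding Phi_def quad_shift_eq_sum
proof (intro sum.cong refl)
  fix j assume "j \<in> {..k}"
  define T where "T = complex_of_real (1 - x\<^sup>2)"
  have 1: "T ^ (k - j) * (- T / 2) ^ (2 * j) = T ^ (k + j) / 4 ^ j"
    using \<open>j \<in> {..k}\<close> by (intro power_diff_mult_half_power) simp
  show "of_nat (k choose j) * (of_real (1 - x\<^sup>2) ^ (k + j) / 4 ^ j) *
        jacobi_poly (int n - 2 * int j) (2 * of_nat j - 1/2) (2 * of_nat j - 1/2) x =
      of_nat (k choose j) * of_real (1 - x\<^sup>2) ^ (k - j) * ultra x n (0 + 2 * j)"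
    unfolding ultra_eq_jacobi_poly[OF assms] T_def[symmetric] 1[symmetric] by simp
qed

text \<open>The weights now have odd index 2 j + 1: the additional factor -(1 - x^2) / 2 stands in
  front of the sum, and the parameters become 2 j + 1/2.\<close>

lemma Psi_eq_quad_shift:
  assumes "-1 < x" "x < 1"
  shows "Psi k x n = quad_shift (of_real (1 - x\<^sup>2)) (ultra x n) k 1"
  unfolding Psi_def quad_shift_eq_sum sum_distrib_left
proof (intro sum.cong refl)
  fix j assume "j \<in> {..k}"
  define T where "T = complex_of_real (1 - x\<^sup>2)"
  have 1: "T ^ (k - j) * (- T / 2) ^ (2 * j) = T ^ (k + j) / 4 ^ j"
    using \<open>j \<in> {..k}\<close> by (intro power_diff_mult_half_power) simp
  have 2: "of_nat (1 + 2 * j) - 1/2 = (2 * of_nat j + 1/2 :: complex)" "int (1 + 2 * j) = 1 + 2 * int j"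
    by simp_all
  show "- (1/2) * of_real (1 - x\<^sup>2) * (of_nat (k choose j) * (of_real (1 - x\<^sup>2) ^ (k + j) / 4 ^ j) *
        jacobi_poly (int n - 1 - 2 * int j) (2 * of_nat j + 1/2) (2 * of_nat j + 1/2) x) =
      of_nat (k choose j) * of_real (1 - x\<^sup>2) ^ (k - j) * ultra x n (1 + 2 * j)"
    unfolding ultra_eq_jacobi_poly[OF assms] T_def[symmetric] 1[symmetric] 2 by (simp add: diff_diff_eq)
qed

text \<open>A point of the cuts is a real t with |t| \<ge> 1 - |x|, so that t^2 + 1 - x^2 \<ge> (1 -
  |x|)^2 + 1 - x^2 = 2 (1 - |x|). Hence the oval misses the cuts.\<close>

lemma jacobi_f_holomorphic_on_oval:
  assumes "-1 < x" "x < 1"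
  shows "jacobi_f \<alpha> \<beta> x holomorphic_on {w. cmod (w\<^sup>2 - (w0 x)\<^sup>2) < 2 * (1 - \<bar>x\<bar>)}"
proof -
  have x: "x\<^sup>2 < 1" using assms by (simp add: abs_square_less_1)
  have w0: "(w0 x)\<^sup>2 = - of_real (1 - x\<^sup>2)"
    using x by (simp add: w0_def power_mult_distrib flip: of_real_power)
  have "{w. cmod (w\<^sup>2 - (w0 x)\<^sup>2) < 2 * (1 - \<bar>x\<bar>)} \<subseteq> cut_plane x"
  proof (rule subsetI, rule ccontr)
    fix w assume w: "w \<in> {w. cmod (w\<^sup>2 - (w0 x)\<^sup>2) < 2 * (1 - \<bar>x\<bar>)}" "w \<notin> cut_plane x"
    then obtain t where t: "w = of_real t" "t \<le> -1 - x \<or> t \<ge> 1 - x"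
      by (auto simp: cut_plane_def)
    have "w\<^sup>2 - (w0 x)\<^sup>2 = of_real (t\<^sup>2 + (1 - x\<^sup>2))" by (simp add: t w0)
    then have "cmod (w\<^sup>2 - (w0 x)\<^sup>2) = \<bar>t\<^sup>2 + (1 - x\<^sup>2)\<bar>" by (simp only: norm_of_real)
    then have "t\<^sup>2 + (1 - x\<^sup>2) < 2 * (1 - \<bar>x\<bar>)" using w by simp
    moreover have "t\<^sup>2 \<ge> (1 - \<bar>x\<bar>)\<^sup>2"
    proof -
      have "1 - \<bar>x\<bar> \<le> \<bar>t\<bar>" using t(2) assms by auto
      then show ?thesis using assms by (subst power2_abs[of t, symmetric]) (intro power_mono, auto)
    qed
    moreover have "(1 - \<bar>x\<bar>)\<^sup>2 + (1 - x\<^sup>2) = 2 * (1 - \<bar>x\<bar>)" by (simp add: power2_eq_square algebra_simps)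
    ultimately show False by linarith
  qed
  moreover have "jacobi_f \<alpha> \<beta> x holomorphic_on cut_plane x"
    unfolding jacobi_f_def by (intro holomorphic_intros) (auto simp: mem_cut_plane_iff)
  ultimately show ?thesis by (rule holomorphic_on_subset[rotated])
qed

text \<open>Uniform convergence near 0 gives convergence of each Taylor coefficient at 0, and
  \<open>jacobi_poly_eq_sum_ultra\<close> involves only n + 1 of them.\<close>

lemma jacobi_poly_expansion:
  assumes x: "-1 < x" "x < 1"
  shows "(\<lambda>k. coeff_A \<alpha> \<beta> x k * Phi k x n + coeff_B \<alpha> \<beta> x k * Psi k x n) sums jacobi_poly (int n) \<alpha> \<beta> x"
proof -
  define A B where "A = coeff_A \<alpha> \<beta> x" and "B = coeff_B \<alpha> \<beta> x"
  define f where "f = jacobi_f \<alpha> \<beta> x"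
  define c where "c = w0 x"
  define T where "T = complex_of_real (1 - x\<^sup>2)"
  have x2: "x\<^sup>2 < 1" using x by (simp add: abs_square_less_1)
  have c2: "c\<^sup>2 = - T"
    using x2 by (simp add: c_def w0_def T_def power_mult_distrib flip: of_real_power)
  have "T \<noteq> 0" using x2 by (simp add: T_def del: of_real_diff)
  then have "c \<noteq> 0" using c2 by auto
  have nT: "cmod T = 1 - x\<^sup>2" using x2 by (simp add: T_def del: of_real_diff)
  define r where "r = 2 * (1 - \<bar>x\<bar>)"
  have "1 - x\<^sup>2 = (1 - \<bar>x\<bar>) * (1 + \<bar>x\<bar>)" by (simp add: algebra_simps flip: power2_eq_square)
  also have "\<dots> < (1 - \<bar>x\<bar>) * 2" using x by (intro mult_strict_left_mono) auto
  finally have "1 - x\<^sup>2 < r" by (simp add: r_def)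
  \<comment> \<open>With this s the oval contains 0, where the modulus is 1 - x^2, and stays where f
    is holomorphic.\<close>
  then obtain s where s: "1 - x\<^sup>2 < s" "s < r" using dense by blast
  let ?S = "\<lambda>N w. \<Sum>k<N. (A k + B k * w) * (w\<^sup>2 - c\<^sup>2) ^ k"
  \<comment> \<open>The partial sum \<open>?S N\<close> as a formal power series at 0; c^2 = -T
    turns its quadratic factor into X^2 + T.\<close>
  let ?F = "\<lambda>N. \<Sum>k<N. (fps_const (A k) + fps_const (B k) * fps_X) * (fps_X ^ 2 + fps_const T) ^ k"
  have "uniform_limit {w. cmod (w\<^sup>2 - c\<^sup>2) \<le> s} ?S f sequentially"
    using two_point_taylor_uniform_limit[of f c r A B s] jacobi_f_holomorphic_on_oval[OF x] coeffs_well_defined[OF x]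
      \<open>c \<noteq> 0\<close> s x2 by (simp add: A_def B_def c_def f_def r_def)
  then have ul: "uniform_limit {w. cmod (w\<^sup>2 - c\<^sup>2) < s} ?S f sequentially"
    by (rule uniform_limit_on_subset) auto
  have coeff: "(\<lambda>N. fps_nth (?F N) i) \<longlonglongrightarrow> (deriv ^^ i) f 0 / fact i" for i
  proof -
    \<comment> \<open>Weierstrass: derivatives of every order pass to locally uniform limits of
      holomorphic functions.\<close>
    have "(\<lambda>N. (deriv ^^ i) (?S N) 0) \<longlonglongrightarrow> (deriv ^^ i) f 0"
    proof (rule higher_deriv_complex_uniform_limit[OF ul])
      show "open {w. cmod (w\<^sup>2 - c\<^sup>2) < s}" by (intro open_Collect_less continuous_intros)
    qed (use s nT c2 in \<open>auto intro!: always_eventually holomorphic_intros\<close>)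
    moreover have "(?S N) has_fps_expansion ?F N" for N
      unfolding c2 diff_minus_eq_add
      by (intro fps_expansion_intros)
    then have "fps_nth (?F N) i = (deriv ^^ i) (?S N) 0 / fact i" for N
      by (rule fps_nth_fps_expansion)
    ultimately show ?thesis
      by (simp only:) (intro tendsto_intros, simp_all)
  qed
  have zero: "i > n \<Longrightarrow> ultra x n i = 0" for i by (rule ultra_eq_0)
  have "(\<Sum>k<N. A k * Phi k x n + B k * Psi k x n) = fps_pairing n (ultra x n) (?F N)" for N
  proof -
    have "fps_pairing n (ultra x n) ((fps_const a + fps_const b * fps_X) * (fps_X ^ 2 + fps_const T) ^ k) =
        a * Phi k x n + b * Psi k x n" for a b k
    proof -
      have e: "(fps_const a + fps_const b * fps_X) * (fps_X ^ 2 + fps_const T) ^ k =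
          fps_const a * (fps_X ^ 2 + fps_const T) ^ k + fps_const b * (fps_X * (fps_X ^ 2 + fps_const T) ^ k)"
        by (simp add: algebra_simps)
      have q: "fps_pairing n (\<lambda>i. ultra x n (i + m)) ((fps_X ^ 2 + fps_const T) ^ k) = quad_shift T (ultra x n) k m" for m
        using zero by (rule fps_pairing_quad_power)
      have X: "fps_pairing n (ultra x n) (fps_X * F) = fps_pairing n (\<lambda>i. ultra x n (Suc i)) F" for F
        using zero by (rule fps_pairing_X_mult)
      show ?thesis
        unfolding e fps_pairing_add fps_pairing_const_mult X Phi_eq_quad_shift[OF x] Psi_eq_quad_shift[OF x]
        using q[of 0] q[of 1] by (simp add: T_def)
    qed
    then show ?thesis by (simp add: fps_pairing_sum)
  qed
  moreover have "(\<lambda>N. fps_pairing n (ultra x n) (?F N)) \<longlonglongrightarrow> jacobi_poly (int n) \<alpha> \<beta> x"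
    unfolding fps_pairing_def jacobi_poly_eq_sum_ultra[OF x] f_def[symmetric]
    by (intro tendsto_intros coeff)
  ultimately show ?thesis by (simp add: sums_def A_def B_def)
qed

section \<open>The order in n\<close>

lemma quad_shift_ultra_bigo:
  assumes "-1 < x" "x < 1"
  shows "(\<lambda>n. quad_shift (of_real (1 - x\<^sup>2)) (ultra x n) k m) \<in> O(\<lambda>n. of_nat n powi (- \<lfloor>(real k + 1) / 2\<rfloor>))"
proof -
  have fl: "\<lfloor>(real k + 1) / 2\<rfloor> = int ((k + 1) div 2)"
    using floor_divide_of_nat_eq[of "k + 1" 2, where 'a = real] by (simp add: add.commute)
  have "(of_nat n + of_nat (Suc m)) * ultra x n (m + 2) + of_real x * of_nat (2 * m + 1) * ultra x n (Suc m) +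
      of_real (1 - x\<^sup>2) * (of_nat n - of_nat m) * ultra x n m = 0" for n m
    using ultra_rec[of n m] by (simp only: of_nat_add)
  then obtain C where C: "\<And>n. real n ^ ((k + 1) div 2) * norm (quad_shift (of_real (1 - x\<^sup>2)) (ultra x n) k m) \<le> C"
    using norm_quad_shift_le_power[where c = "ultra x" and X = "of_real x", OF _ ultra_bounded[OF assms]]
    by blast
  show ?thesis
  \<comment> \<open>At n = 0 a negative power is 0 by convention, so the estimate is made for n > 0
    only.\<close>
  proof (rule bigoI[of _ C], rule eventually_mono[OF eventually_gt_at_top[of 0]])
    fix n :: nat assume "n > 0"
    have eq: "norm (of_nat n powi (- \<lfloor>(real k + 1) / 2\<rfloor>) :: complex) = inverse (real n ^ ((k + 1) div 2))"
      unfolding fl by (simp add: power_int_minus norm_inverse norm_power)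
    show "norm (quad_shift (of_real (1 - x\<^sup>2)) (ultra x n) k m) \<le>
        C * norm (of_nat n powi (- \<lfloor>(real k + 1) / 2\<rfloor>) :: complex)"
      unfolding eq using C[of n] \<open>n > 0\<close> by (simp add: field_simps)
  qed
qed

theorem theorem5p1:
  fixes \<alpha> \<beta> :: complex
  shows "(\<forall>n::nat. \<forall>x::real. n > 0 \<longrightarrow> -1 < x \<longrightarrow> x < 1 \<longrightarrow>
            (\<lambda>k. coeff_A \<alpha> \<beta> x k * Phi k x n + coeff_B \<alpha> \<beta> x k * Psi k x n)
              sums jacobi_poly (int n) \<alpha> \<beta> x)
       \<and> (\<forall>k::nat. \<forall>x::real. -1 < x \<longrightarrow> x < 1 \<longrightarrow>
            (\<lambda>n. Phi k x n) \<in> O(\<lambda>n. of_nat n powi (- \<lfloor>(real k + 1) / 2\<rfloor>)) \<and>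
            (\<lambda>n. Psi k x n) \<in> O(\<lambda>n. of_nat n powi (- \<lfloor>(real k + 1) / 2\<rfloor>)))"
  using jacobi_poly_expansion quad_shift_ultra_bigo[of _ _ 0] quad_shift_ultra_bigo[of _ _ 1]
  by (simp flip: Phi_eq_quad_shift Psi_eq_quad_shift One_nat_def del: of_real_diff)

end
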